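(* Let $\Gamma$ be an oriented Jordan smooth curve, $\alpha$ an orientation preserving diffeomorphism of $\Gamma$ onto itself with a nonempty set $\Lambda$ of fixed points, and $X(\Gamma)$ a rearrangement-invariant space with nontrivial Boyd indices $\alpha_X,\beta_X$. For every $g\in C(\Gamma)$ the spectral radius of $gW$ on $X(\Gamma)$ satisfies \[ r(gW;X(\Gamma))\le\max_{\tau\in\Lambda}\Big(|g(\tau)|\max\{|\alpha'(\tau)|^{-\alpha_X},|\alpha'(\tau)|^{-\beta_X}\}\Big). \]
   Context: $X(\Gamma)$ is an r.-i. Banach function space over $(\Gamma,|d\tau|)$. Boyd indices: with Luxemburg representation $\overline X$ over $[0,|\Gamma|]$, $(E_xf)(s)=f(xs)$ if $xs\in[0,|\Gamma|]$ and $0$ otherwise, $h_X(x)=\|E_{1/x}\|_{\mathcal B(\overline X)}$, $\alpha_X=\lim_{x\to0}\log h_X(x)/\log x$, $\beta_X=\lim_{x\to\infty}\log h_X(x)/\log x$; nontrivial means $0<\alpha_X\le\beta_X<1$. $(Wf)(t)=f[\alpha(t)]$. *)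

theory Defs
  imports "HOL-Analysis.Analysis"
begin

text \<open>An oriented smooth Jordan curve of length L, given by an L-periodic, C1
  arc-length parametrisation (unit speed, hence regular) that is injective on one period.
  The orientation is the direction of increasing parameter.\<close>

definition smooth_jordan_curve :: "(real \<Rightarrow> complex) \<Rightarrow> real \<Rightarrow> bool" where
  "smooth_jordan_curve \<gamma> L \<longleftrightarrow>
     0 < L \<and> (\<forall>s. \<gamma> (s + L) = \<gamma> s) \<and> inj_on \<gamma> {0..<L} \<and>
     (\<exists>\<gamma>'. (\<forall>s. (\<gamma> has_vector_derivative \<gamma>' s) (at s)) \<and>
           continuous_on UNIV \<gamma>' \<and> (\<forall>s. norm (\<gamma>' s) = 1))"

definition curve_set :: "(real \<Rightarrow> complex) \<Rightarrow> real \<Rightarrow> complex set" where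
  "curve_set \<gamma> L = \<gamma> ` {0..L}"

definition arc_measure :: "(real \<Rightarrow> complex) \<Rightarrow> real \<Rightarrow> complex measure" where
  "arc_measure \<gamma> L =
     distr (restrict_space lborel {0..<L}) (restrict_space borel (curve_set \<gamma> L)) \<gamma>"

definition arc_coord :: "(real \<Rightarrow> complex) \<Rightarrow> real \<Rightarrow> complex \<Rightarrow> real" where
  "arc_coord \<gamma> L \<tau> = the_inv_into {0..<L} \<gamma> \<tau>"

definition curve_C1 :: "complex set \<Rightarrow> (complex \<Rightarrow> complex) \<Rightarrow> bool" where
  "curve_C1 \<Gamma> f \<longleftrightarrow>
     (\<exists>f'. (\<forall>\<tau>\<in>\<Gamma>. (f has_field_derivative f' \<tau>) (at \<tau> within \<Gamma>)) \<and> continuous_on \<Gamma> f')"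

definition curve_deriv :: "complex set \<Rightarrow> (complex \<Rightarrow> complex) \<Rightarrow> complex \<Rightarrow> complex" where
  "curve_deriv \<Gamma> f \<tau> = (THE d. (f has_field_derivative d) (at \<tau> within \<Gamma>))"

definition curve_diffeo :: "complex set \<Rightarrow> (complex \<Rightarrow> complex) \<Rightarrow> bool" where
  "curve_diffeo \<Gamma> \<alpha> \<longleftrightarrow>
     bij_betw \<alpha> \<Gamma> \<Gamma> \<and> curve_C1 \<Gamma> \<alpha> \<and> curve_C1 \<Gamma> (the_inv_into \<Gamma> \<alpha>)"

definition orientation_preserving :: "(real \<Rightarrow> complex) \<Rightarrow> (complex \<Rightarrow> complex) \<Rightarrow> bool" where
  "orientation_preserving \<gamma> \<alpha> \<longleftrightarrow>
     (\<exists>\<phi>::real \<Rightarrow> real. continuous_on UNIV \<phi> \<and> strict_mono \<phi> \<and> (\<forall>s. \<alpha> (\<gamma> s) = \<gamma> (\<phi> s)))"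

definition banach_function_norm :: "'a measure \<Rightarrow> (('a \<Rightarrow> ennreal) \<Rightarrow> ennreal) \<Rightarrow> bool" where
  "banach_function_norm M \<rho> \<longleftrightarrow>
     (\<forall>f\<in>borel_measurable M. \<rho> f = 0 \<longleftrightarrow> (AE x in M. f x = 0)) \<and>
     (\<forall>f\<in>borel_measurable M. \<forall>a::real. a \<ge> 0 \<longrightarrow> \<rho> (\<lambda>x. ennreal a * f x) = ennreal a * \<rho> f) \<and>
     (\<forall>f\<in>borel_measurable M. \<forall>g\<in>borel_measurable M. \<rho> (\<lambda>x. f x + g x) \<le> \<rho> f + \<rho> g) \<and>
     (\<forall>f\<in>borel_measurable M. \<forall>g\<in>borel_measurable M.
        (AE x in M. g x \<le> f x) \<longrightarrow> \<rho> g \<le> \<rho> f) \<and>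
     (\<forall>F f. (\<forall>n. F n \<in> borel_measurable M) \<longrightarrow> f \<in> borel_measurable M \<longrightarrow>
        (AE x in M. incseq (\<lambda>n. F n x) \<and> (\<lambda>n. F n x) \<longlonglongrightarrow> f x) \<longrightarrow>
        (SUP n. \<rho> (F n)) = \<rho> f) \<and>
     (\<forall>E\<in>sets M. emeasure M E < \<infinity> \<longrightarrow> \<rho> (indicator E) < \<infinity>) \<and>
     (\<forall>E\<in>sets M. emeasure M E < \<infinity> \<longrightarrow>
        (\<exists>C::real. \<forall>f\<in>borel_measurable M. (\<integral>\<^sup>+x\<in>E. f x \<partial>M) \<le> ennreal C * \<rho> f))"

definition equimeasurable :: "'a measure \<Rightarrow> ('a \<Rightarrow> ennreal) \<Rightarrow> 'b measure \<Rightarrow> ('b \<Rightarrow> ennreal) \<Rightarrow> bool" where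
  "equimeasurable M f N g \<longleftrightarrow>
     (\<forall>t::real. t \<ge> 0 \<longrightarrow>
        emeasure M {x\<in>space M. f x > ennreal t} = emeasure N {x\<in>space N. g x > ennreal t})"

definition rearrangement_invariant :: "'a measure \<Rightarrow> (('a \<Rightarrow> ennreal) \<Rightarrow> ennreal) \<Rightarrow> bool" where
  "rearrangement_invariant M \<rho> \<longleftrightarrow>
     (\<forall>f\<in>borel_measurable M. \<forall>g\<in>borel_measurable M. equimeasurable M f M g \<longrightarrow> \<rho> f = \<rho> g)"

definition ri_bfs :: "'a measure \<Rightarrow> (('a \<Rightarrow> ennreal) \<Rightarrow> ennreal) \<Rightarrow> bool" where
  "ri_bfs M \<rho> \<longleftrightarrow> banach_function_norm M \<rho> \<and> rearrangement_invariant M \<rho>"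

definition X_space :: "'a measure \<Rightarrow> (('a \<Rightarrow> ennreal) \<Rightarrow> ennreal) \<Rightarrow> ('a \<Rightarrow> complex) set" where
  "X_space M \<rho> = {f \<in> borel_measurable M. \<rho> (\<lambda>x. ennreal (cmod (f x))) < \<infinity>}"

definition X_norm :: "(('a \<Rightarrow> ennreal) \<Rightarrow> ennreal) \<Rightarrow> ('a \<Rightarrow> complex) \<Rightarrow> real" where
  "X_norm \<rho> f = enn2real (\<rho> (\<lambda>x. ennreal (cmod (f x))))"

definition bounded_invertible_on :: "'a measure \<Rightarrow> (('a \<Rightarrow> ennreal) \<Rightarrow> ennreal) \<Rightarrow>
    (('a \<Rightarrow> complex) \<Rightarrow> ('a \<Rightarrow> complex)) \<Rightarrow> bool" where
  "bounded_invertible_on M \<rho> A \<longleftrightarrow>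
     (\<exists>S. (\<forall>f\<in>X_space M \<rho>. S f \<in> X_space M \<rho>) \<and>
          (\<forall>f\<in>X_space M \<rho>. \<forall>g\<in>X_space M \<rho>. \<forall>c::complex.
              AE x in M. S (\<lambda>y. c * f y + g y) x = c * S f x + S g x) \<and>
          (\<exists>C::real. \<forall>f\<in>X_space M \<rho>. X_norm \<rho> (S f) \<le> C * X_norm \<rho> f) \<and>
          (\<forall>f\<in>X_space M \<rho>. AE x in M. S (A f) x = f x) \<and>
          (\<forall>f\<in>X_space M \<rho>. AE x in M. A (S f) x = f x))"

definition op_spectrum :: "'a measure \<Rightarrow> (('a \<Rightarrow> ennreal) \<Rightarrow> ennreal) \<Rightarrow>
    (('a \<Rightarrow> complex) \<Rightarrow> ('a \<Rightarrow> complex)) \<Rightarrow> complex set" where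
  "op_spectrum M \<rho> T =
     {z. \<not> bounded_invertible_on M \<rho> (\<lambda>f x. z * f x - T f x)}"

definition spectral_radius :: "'a measure \<Rightarrow> (('a \<Rightarrow> ennreal) \<Rightarrow> ennreal) \<Rightarrow>
    (('a \<Rightarrow> complex) \<Rightarrow> ('a \<Rightarrow> complex)) \<Rightarrow> real" where
  "spectral_radius M \<rho> T = Sup (cmod ` op_spectrum M \<rho> T)"

definition weighted_shift :: "(complex \<Rightarrow> complex) \<Rightarrow> (complex \<Rightarrow> complex) \<Rightarrow>
    (complex \<Rightarrow> complex) \<Rightarrow> (complex \<Rightarrow> complex)" where
  "weighted_shift g \<alpha> f = (\<lambda>t. g t * f (\<alpha> t))"

text \<open>Luxemburg representation: rho_bar h = rho(h o s) where s is the arc-length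
  coordinate; this is a measure-preserving isomorphism of (Gamma,|d tau|) with [0,L),
  so for r.i. rho it is the (unique) Luxemburg representation.\<close>
definition lux_rep :: "(real \<Rightarrow> complex) \<Rightarrow> real \<Rightarrow> ((complex \<Rightarrow> ennreal) \<Rightarrow> ennreal) \<Rightarrow>
    (real \<Rightarrow> ennreal) \<Rightarrow> ennreal" where
  "lux_rep \<gamma> L \<rho> h = \<rho> (\<lambda>\<tau>. h (arc_coord \<gamma> L \<tau>))"

definition dilation :: "real \<Rightarrow> real \<Rightarrow> (real \<Rightarrow> ennreal) \<Rightarrow> real \<Rightarrow> ennreal" where
  "dilation L x h s = (if x * s \<in> {0..L} then h (x * s) else 0)"

definition boyd_h :: "(real \<Rightarrow> complex) \<Rightarrow> real \<Rightarrow> ((complex \<Rightarrow> ennreal) \<Rightarrow> ennreal) \<Rightarrow> real \<Rightarrow> real" where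
  "boyd_h \<gamma> L \<rho> x = enn2real (SUP h\<in>{h\<in>borel_measurable (restrict_space lborel {0..L}).
                                        lux_rep \<gamma> L \<rho> h \<le> 1}.
                                  lux_rep \<gamma> L \<rho> (dilation L (1 / x) h))"

definition boyd_lower :: "(real \<Rightarrow> complex) \<Rightarrow> real \<Rightarrow> ((complex \<Rightarrow> ennreal) \<Rightarrow> ennreal) \<Rightarrow> real" where
  "boyd_lower \<gamma> L \<rho> = Lim (at_right 0) (\<lambda>x. ln (boyd_h \<gamma> L \<rho> x) / ln x)"

definition boyd_upper :: "(real \<Rightarrow> complex) \<Rightarrow> real \<Rightarrow> ((complex \<Rightarrow> ennreal) \<Rightarrow> ennreal) \<Rightarrow> real" where
  "boyd_upper \<gamma> L \<rho> = Lim at_top (\<lambda>x. ln (boyd_h \<gamma> L \<rho> x) / ln x)"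

end

theory Submission
  imports Defs "HOL-Complex_Analysis.Cauchy_Integral_Formula"
begin

text \<open>The \<open>n\<close>-th power of \<open>gW\<close> is \<open>f \<mapsto> g\<^sub>n \<cdot> (f \<circ> \<alpha>\<^sup>n)\<close> with \<open>g\<^sub>n = \<Prod>\<^sub>j g \<circ> \<alpha>\<^sup>j\<close>. Where \<open>|(\<alpha>\<^sup>n)'| \<approx> e\<^sup>k\<close>,
  composition with \<open>\<alpha>\<^sup>n\<close> multiplies distribution functions by at most \<open>e\<^sup>-\<^sup>k\<close>, so on that part of the
  curve its norm is at most \<open>h\<^sub>X(e\<^sup>-\<^sup>k)\<close>; there are only \<open>O(n)\<close> such parts. Submultiplicativity
  gives \<open>h\<^sub>X(x) \<le> C max(x\<^sup>a, x\<^sup>b)\<close> for \<open>a < \<alpha>\<^sub>X\<close> and \<open>b > \<beta>\<^sub>X\<close>, and since \<open>max(x\<^sup>a, x\<^sup>b)\<close> is itself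
  submultiplicative, \<open>\<parallel>(gW)\<^sup>n\<parallel>\<close> is bounded up to a factor \<open>O(n)\<close> by the supremum of the orbit products
  of \<open>w = |g| max(|\<alpha>'|\<^sup>-\<^sup>a, |\<alpha>'|\<^sup>-\<^sup>b)\<close>. Because \<open>\<alpha>\<close> has fixed points and preserves orientation, every
  orbit stays near the fixed points except for a uniformly bounded number of steps, so only the
  values of \<open>w\<close> at the fixed points matter. The real supremum defining the spectral radius is
  meaningful only for a nonempty spectrum, so nonemptiness has to be proved as well.\<close>

section \<open>Banach function norms and the spectrum\<close>

text \<open>The bound couples \<open>g\<close> and the derivative of \<alpha> at one and the same
  point, so estimating the factor \<open>g_n\<close> and the composition separately would lose it.
  Slicing by the derivative of the iterate keeps the pairing, and a polynomial number of slices does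
  not change an exponential rate. Composition and dilation are compared through distribution
  functions alone, which is where rearrangement invariance enters. As the curve has finite length,
  dilations are cut off at \<open>L\<close>; cutting between two dilations can lose mass, so
  submultiplicativity is proved only with the factors in a favourable order. The growth bound is
  obtained only for exponents strictly outside the index interval; since \<open>ln jac\<close> is
  bounded, moving the exponents slightly changes the weight by a factor close to 1. The indices are
  \<open>Lim\<close> values of quotients formed after \<open>enn2real\<close>, hence say nothing
  until the norms are known to be finite and the limits to exist. Finally, operators act on
  functions rather than on classes, so every resolvent identity holds almost everywhere
  only.\<close>

locale bfn = finite_measure M for M :: "'a measure" +
  fixes \<rho> :: "('a \<Rightarrow> ennreal) \<Rightarrow> ennreal"
  assumes bfn: "banach_function_norm M \<rho>"
begin

lemma rho_zero_iff: "f \<in> borel_measurable M \<Longrightarrow> \<rho> f = 0 \<longleftrightarrow> (AE x in M. f x = 0)"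
  using bfn unfolding banach_function_norm_def by blast

lemma rho_scale: "f \<in> borel_measurable M \<Longrightarrow> a \<ge> 0 \<Longrightarrow> \<rho> (\<lambda>x. ennreal a * f x) = ennreal a * \<rho> f"
  using bfn unfolding banach_function_norm_def by blast

lemma rho_add: "f \<in> borel_measurable M \<Longrightarrow> g \<in> borel_measurable M \<Longrightarrow> \<rho> (\<lambda>x. f x + g x) \<le> \<rho> f + \<rho> g"
  using bfn unfolding banach_function_norm_def by blast

lemma rho_mono:
  "f \<in> borel_measurable M \<Longrightarrow> g \<in> borel_measurable M \<Longrightarrow> (AE x in M. g x \<le> f x) \<Longrightarrow> \<rho> g \<le> \<rho> f"
  using bfn unfolding banach_function_norm_def by blast

lemma rho_cong:
  "f \<in> borel_measurable M \<Longrightarrow> g \<in> borel_measurable M \<Longrightarrow> (AE x in M. g x = f x) \<Longrightarrow> \<rho> g = \<rho> f"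
  by (intro antisym rho_mono) auto

lemma rho_fatou:
  "(\<And>n. F n \<in> borel_measurable M) \<Longrightarrow> f \<in> borel_measurable M \<Longrightarrow>
   (AE x in M. incseq (\<lambda>n. F n x) \<and> (\<lambda>n. F n x) \<longlonglongrightarrow> f x) \<Longrightarrow> (SUP n. \<rho> (F n)) = \<rho> f"
  using bfn unfolding banach_function_norm_def by blast

lemma rho_one_finite: "\<rho> (\<lambda>_. 1) < \<infinity>"
proof -
  have "\<forall>E\<in>sets M. emeasure M E < \<infinity> \<longrightarrow> \<rho> (indicator E) < \<infinity>"
    using bfn unfolding banach_function_norm_def by blast
  then have "\<rho> (indicator (space M)) < \<infinity>"
    by (auto simp: less_top[symmetric])
  moreover have "\<rho> (\<lambda>_. 1) = \<rho> (indicator (space M))"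
    by (rule rho_cong) (auto intro!: AE_I2)
  ultimately show ?thesis by simp
qed

lemma integral_bound:
  obtains K :: real where "K > 0"
    "\<And>f. f \<in> borel_measurable M \<Longrightarrow> (\<integral>\<^sup>+x. f x \<partial>M) \<le> ennreal K * \<rho> f"
proof -
  have "\<forall>E\<in>sets M. emeasure M E < \<infinity> \<longrightarrow>
      (\<exists>C::real. \<forall>f\<in>borel_measurable M. (\<integral>\<^sup>+x\<in>E. f x \<partial>M) \<le> ennreal C * \<rho> f)"
    using bfn unfolding banach_function_norm_def by blast
  then have "\<exists>C::real. \<forall>f\<in>borel_measurable M. (\<integral>\<^sup>+x\<in>space M. f x \<partial>M) \<le> ennreal C * \<rho> f"
    using emeasure_finite[of "space M"] sets.top[of M] unfolding infinity_ennreal_def less_top by blast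
  then obtain C where C: "\<And>f. f\<in>borel_measurable M \<Longrightarrow> (\<integral>\<^sup>+x\<in>space M. f x \<partial>M) \<le> ennreal C * \<rho> f"
    by blast
  show thesis
  proof (rule that[of "max C 1"])
    fix f :: "'a \<Rightarrow> ennreal" assume f: "f \<in> borel_measurable M"
    have "(\<integral>\<^sup>+x. f x \<partial>M) = (\<integral>\<^sup>+x\<in>space M. f x \<partial>M)"
      by (intro nn_integral_cong) auto
    also have "\<dots> \<le> ennreal C * \<rho> f" by (rule C[OF f])
    also have "\<dots> \<le> ennreal (max C 1) * \<rho> f"
      by (intro mult_right_mono ennreal_leI) auto
    finally show "(\<integral>\<^sup>+x. f x \<partial>M) \<le> ennreal (max C 1) * \<rho> f" .
  qed simp
qed

lemma AE_finite_of_rho_finite: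
  assumes f: "f \<in> borel_measurable M" and fin: "\<rho> f < \<infinity>"
  shows "AE x in M. f x < \<infinity>"
proof -
  obtain K :: real where K: "(\<integral>\<^sup>+x. f x \<partial>M) \<le> ennreal K * \<rho> f"
    using f by (auto intro: integral_bound)
  also have "\<dots> < \<infinity>" using fin by (simp add: ennreal_mult_less_top)
  finally have "(\<integral>\<^sup>+x. f x \<partial>M) \<noteq> \<infinity>" by simp
  from nn_integral_PInf_AE[OF f this] show ?thesis by (auto simp: less_top)
qed

lemma rho_sum:
  assumes "finite I" "\<And>i. i \<in> I \<Longrightarrow> f i \<in> borel_measurable M"
  shows "\<rho> (\<lambda>x. \<Sum>i\<in>I. f i x) \<le> (\<Sum>i\<in>I. \<rho> (f i))"
  using assms
proof (induction I rule: finite_induct)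
  case empty
  have "\<rho> (\<lambda>_. 0) = 0" by (subst rho_zero_iff) auto
  then show ?case by simp
next
  case (insert i I)
  have "\<rho> (\<lambda>x. f i x + (\<Sum>i\<in>I. f i x)) \<le> \<rho> (f i) + \<rho> (\<lambda>x. \<Sum>i\<in>I. f i x)"
    using insert by (intro rho_add) auto
  also have "\<dots> \<le> \<rho> (f i) + (\<Sum>i\<in>I. \<rho> (f i))"
    using insert by (intro add_left_mono) auto
  finally show ?case using insert by simp
qed

text \<open>The Fatou property carries the triangle inequality from finite to countable sums. It
  takes the place of completeness when a Neumann series is summed pointwise.\<close>

lemma rho_suminf:
  assumes f: "\<And>i::nat. f i \<in> borel_measurable M"
  shows "\<rho> (\<lambda>x. \<Sum>i. f i x) \<le> (\<Sum>i. \<rho> (f i))"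
proof -
  have "(SUP n. \<rho> (\<lambda>x. \<Sum>i<n. f i x)) = \<rho> (\<lambda>x. \<Sum>i. f i x)"
    using f by (intro rho_fatou AE_I2)
      (auto intro!: incseq_SucI summable_LIMSEQ)
  moreover have "\<rho> (\<lambda>x. \<Sum>i<n. f i x) \<le> (\<Sum>i. \<rho> (f i))" for n
  proof -
    have "\<rho> (\<lambda>x. \<Sum>i<n. f i x) \<le> (\<Sum>i<n. \<rho> (f i))" by (rule rho_sum) (auto intro: f)
    also have "\<dots> \<le> (\<Sum>i. \<rho> (f i))" by (intro sum_le_suminf) auto
    finally show ?thesis .
  qed
  ultimately show ?thesis using SUP_least[of UNIV "\<lambda>n. \<rho> (\<lambda>x. \<Sum>i<n. f i x)"] by simp
qed

lemma X_spaceD: "f \<in> X_space M \<rho> \<Longrightarrow> f \<in> borel_measurable M"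
  "f \<in> X_space M \<rho> \<Longrightarrow> \<rho> (\<lambda>x. ennreal (cmod (f x))) = ennreal (X_norm \<rho> f)"
  by (auto simp: X_space_def X_norm_def)

lemma X_norm_nonneg: "X_norm \<rho> f \<ge> 0"
  by (simp add: X_norm_def)

lemma X_norm_leI:
  assumes "f \<in> borel_measurable M" "\<rho> (\<lambda>x. ennreal (cmod (f x))) \<le> ennreal a" "a \<ge> 0"
  shows "f \<in> X_space M \<rho>" "X_norm \<rho> f \<le> a"
proof -
  show "f \<in> X_space M \<rho>"
    using assms by (auto simp: X_space_def intro: le_less_trans)
  from X_spaceD(2)[OF this] assms show "X_norm \<rho> f \<le> a"
    by (simp add: X_norm_nonneg)
qed

lemma
  assumes f: "f \<in> X_space M \<rho>" and g: "g \<in> X_space M \<rho>"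
  shows X_space_lincomb: "(\<lambda>x. c * f x + g x) \<in> X_space M \<rho>"
    and X_norm_lincomb: "X_norm \<rho> (\<lambda>x. c * f x + g x) \<le> cmod c * X_norm \<rho> f + X_norm \<rho> g"
proof -
  note [measurable] = X_spaceD(1)[OF f] X_spaceD(1)[OF g]
  have "\<rho> (\<lambda>x. ennreal (cmod (c * f x + g x)))
      \<le> \<rho> (\<lambda>x. ennreal (cmod c) * ennreal (cmod (f x)) + ennreal (cmod (g x)))"
    by (intro rho_mono AE_I2)
      (auto simp: ennreal_mult[symmetric] ennreal_plus[symmetric] norm_mult[symmetric]
        simp del: ennreal_plus intro!: ennreal_leI norm_triangle_ineq)
  also have "\<dots> \<le> \<rho> (\<lambda>x. ennreal (cmod c) * ennreal (cmod (f x))) + \<rho> (\<lambda>x. ennreal (cmod (g x)))"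
    by (intro rho_add) auto
  also have "\<dots> = ennreal (cmod c * X_norm \<rho> f + X_norm \<rho> g)"
    by (subst rho_scale) (auto simp: X_spaceD(2)[OF f] X_spaceD(2)[OF g] X_norm_nonneg ennreal_mult)
  finally have *: "\<rho> (\<lambda>x. ennreal (cmod (c * f x + g x))) \<le> ennreal (cmod c * X_norm \<rho> f + X_norm \<rho> g)" .
  have "(\<lambda>x. c * f x + g x) \<in> borel_measurable M" by measurable
  from X_norm_leI[OF this *] show "(\<lambda>x. c * f x + g x) \<in> X_space M \<rho>"
    "X_norm \<rho> (\<lambda>x. c * f x + g x) \<le> cmod c * X_norm \<rho> f + X_norm \<rho> g"
    by (auto simp: X_norm_nonneg)
qed

lemma X_norm_cong:
  assumes "f \<in> borel_measurable M" "g \<in> borel_measurable M" "AE x in M. f x = g x"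
  shows "X_norm \<rho> f = X_norm \<rho> g"
  unfolding X_norm_def using assms by (intro arg_cong[of _ _ enn2real] rho_cong) auto

lemma X_norm_zero: 
  assumes f: "f \<in> X_space M \<rho>"
  shows "X_norm \<rho> f = 0 \<longleftrightarrow> (AE x in M. f x = 0)"
proof -
  note [measurable] = X_spaceD(1)[OF f]
  have "X_norm \<rho> f = 0 \<longleftrightarrow> \<rho> (\<lambda>x. ennreal (cmod (f x))) = 0"
    by (simp add: X_spaceD(2)[OF f] X_norm_nonneg)
  also have "\<dots> \<longleftrightarrow> (AE x in M. f x = 0)"
    by (subst rho_zero_iff) auto
  finally show ?thesis .
qed

lemma X_space_const: "(\<lambda>_. c) \<in> X_space M \<rho>"
proof -
  have "\<rho> (\<lambda>x. ennreal (cmod c) * 1) = ennreal (cmod c) * \<rho> (\<lambda>_. 1)"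
    by (rule rho_scale) auto
  then show ?thesis using rho_one_finite
    by (auto simp: X_space_def ennreal_mult_less_top)
qed

text \<open>The axiom bounding integrals over sets of finite measure, taken on all of
  \<open>space M\<close>, makes integration a bounded functional. It serves to turn resolvents into
  scalar functions.\<close>

lemma X_integral_bound:
  obtains K :: real where "K > 0"
    "\<And>f. f \<in> X_space M \<rho> \<Longrightarrow> integrable M f"
    "\<And>f. f \<in> X_space M \<rho> \<Longrightarrow> cmod (\<integral>x. f x \<partial>M) \<le> K * X_norm \<rho> f"
proof -
  obtain K :: real where K: "K > 0"
    "\<And>f. f \<in> borel_measurable M \<Longrightarrow> (\<integral>\<^sup>+x. f x \<partial>M) \<le> ennreal K * \<rho> f"
    using integral_bound by blast
  have *: "(\<integral>\<^sup>+x. ennreal (cmod (f x)) \<partial>M) \<le> ennreal (K * X_norm \<rho> f)" if f: "f \<in> X_space M \<rho>" for f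
    using K(2)[of "\<lambda>x. ennreal (cmod (f x))"] K(1) X_spaceD[OF f]
    by (auto simp: ennreal_mult X_norm_nonneg)
  have int: "integrable M f" if f: "f \<in> X_space M \<rho>" for f
    using *[OF f] X_spaceD(1)[OF f] by (intro integrableI_bounded) (auto intro: le_less_trans)
  show thesis
  proof (rule that[OF K(1) int])
    fix f assume f: "f \<in> X_space M \<rho>"
    have "cmod (\<integral>x. f x \<partial>M) \<le> (\<integral>x. cmod (f x) \<partial>M)" by (rule integral_norm_bound)
    moreover have "ennreal (\<integral>x. cmod (f x) \<partial>M) \<le> ennreal (K * X_norm \<rho> f)"
      using *[OF f] by (subst (asm) nn_integral_eq_integral) (auto intro: integrable_norm int f)
    then have "(\<integral>x. cmod (f x) \<partial>M) \<le> K * X_norm \<rho> f"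
      using K(1) X_norm_nonneg[of f] by (simp add: ennreal_le_iff)
    ultimately show "cmod (\<integral>x. f x \<partial>M) \<le> K * X_norm \<rho> f" by (rule order_trans)
  qed
qed

text \<open>Gelfand's argument: if the spectrum were empty, \<open>z \<mapsto> \<integral> (z - T)\<^sup>-\<^sup>1 1\<close> would be an entire
  function \<open>F\<close> vanishing at infinity, hence zero, while \<open>z F(z)\<close> tends to the total mass.\<close>

lemma op_spectrum_nonempty:
  fixes T :: "('a \<Rightarrow> complex) \<Rightarrow> 'a \<Rightarrow> complex"
  assumes M0: "measure M (space M) > 0"
    and TX: "\<And>f. f \<in> X_space M \<rho> \<Longrightarrow> T f \<in> X_space M \<rho>"
    and Tbd: "\<And>f. f \<in> X_space M \<rho> \<Longrightarrow> X_norm \<rho> (T f) \<le> C * X_norm \<rho> f"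
  shows "op_spectrum M \<rho> T \<noteq> {}"
proof
  assume "op_spectrum M \<rho> T = {}"
  then have "\<forall>z. bounded_invertible_on M \<rho> (\<lambda>f x. z * f x - T f x)"
    unfolding op_spectrum_def by auto
  then have "\<forall>z. \<exists>S. (\<forall>f\<in>X_space M \<rho>. S f \<in> X_space M \<rho>) \<and>
      (\<forall>f\<in>X_space M \<rho>. \<forall>g\<in>X_space M \<rho>. \<forall>c::complex.
          AE x in M. S (\<lambda>y. c * f y + g y) x = c * S f x + S g x) \<and>
      (\<exists>C::real. \<forall>f\<in>X_space M \<rho>. X_norm \<rho> (S f) \<le> C * X_norm \<rho> f) \<and>
      (\<forall>f\<in>X_space M \<rho>. AE x in M. S (\<lambda>x. z * f x - T f x) x = f x) \<and>
      (\<forall>f\<in>X_space M \<rho>. AE x in M. z * S f x - T (S f) x = f x)"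
    unfolding bounded_invertible_on_def .
  from choice[OF this] obtain S where S: "\<forall>z. (\<forall>f\<in>X_space M \<rho>. S z f \<in> X_space M \<rho>) \<and>
      (\<forall>f\<in>X_space M \<rho>. \<forall>g\<in>X_space M \<rho>. \<forall>c::complex.
          AE x in M. S z (\<lambda>y. c * f y + g y) x = c * S z f x + S z g x) \<and>
      (\<exists>C::real. \<forall>f\<in>X_space M \<rho>. X_norm \<rho> (S z f) \<le> C * X_norm \<rho> f) \<and>
      (\<forall>f\<in>X_space M \<rho>. AE x in M. S z (\<lambda>x. z * f x - T f x) x = f x) \<and>
      (\<forall>f\<in>X_space M \<rho>. AE x in M. z * S z f x - T (S z f) x = f x)"
    by (elim exE)
  have SX: "S z f \<in> X_space M \<rho>" if "f \<in> X_space M \<rho>" for z f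
    using S that by blast
  have Slin: "AE x in M. S z (\<lambda>y. c * f y + g y) x = c * S z f x + S z g x"
    if "f \<in> X_space M \<rho>" "g \<in> X_space M \<rho>" for z f g c
    using S that by blast
  have Sbd: "\<exists>C. \<forall>f\<in>X_space M \<rho>. X_norm \<rho> (S z f) \<le> C * X_norm \<rho> f" for z
    using S by blast
  have SA: "AE x in M. S z (\<lambda>x. z * f x - T f x) x = f x" if "f \<in> X_space M \<rho>" for z f
    using S that by blast
  have AS: "AE x in M. z * S z f x - T (S z f) x = f x" if "f \<in> X_space M \<rho>" for z f
    using S that by blast
  have "\<forall>z. \<exists>C. \<forall>f\<in>X_space M \<rho>. X_norm \<rho> (S z f) \<le> C * X_norm \<rho> f"
    using Sbd by blast
  from choice[OF this] obtain B
    where B: "\<And>z f. f \<in> X_space M \<rho> \<Longrightarrow> X_norm \<rho> (S z f) \<le> B z * X_norm \<rho> f"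
    by blast
  define B' where "B' z = max 1 (B z)" for z
  have B': "X_norm \<rho> (S z f) \<le> B' z * X_norm \<rho> f" if "f \<in> X_space M \<rho>" for z f
    using B[OF that, of z] mult_right_mono[of "B z" "B' z" "X_norm \<rho> f"] X_norm_nonneg[of f]
    by (auto simp: B'_def)
  have B'1: "B' z \<ge> 1" for z by (simp add: B'_def)
  obtain K :: real where K: "K > 0"
    "\<And>f. f \<in> X_space M \<rho> \<Longrightarrow> integrable M f"
    "\<And>f. f \<in> X_space M \<rho> \<Longrightarrow> cmod (\<integral>x. f x \<partial>M) \<le> K * X_norm \<rho> f"
    using X_integral_bound by blast
  have int_lin: "(\<integral>x. c * f x + g x \<partial>M) = c * (\<integral>x. f x \<partial>M) + (\<integral>x. g x \<partial>M)"
    if "f \<in> X_space M \<rho>" "g \<in> X_space M \<rho>" for c f g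
    using K(2)[OF that(1)] K(2)[OF that(2)] by simp
  \<comment> \<open>Nothing in the definition makes a resolvent respect almost everywhere equality.
    Linearity and boundedness force it: a null difference has norm 0, and so has its image.\<close>
  have Scong: "AE x in M. S z f x = S z g x"
    if f: "f \<in> X_space M \<rho>" and g: "g \<in> X_space M \<rho>" and eq: "AE x in M. f x = g x" for z f g
  proof -
    have h: "(\<lambda>y. (-1) * g y + f y) \<in> X_space M \<rho>" by (intro X_space_lincomb f g)
    have "X_norm \<rho> (\<lambda>y. (-1) * g y + f y) = 0"
      using X_norm_zero[OF h] eq by auto
    then have "X_norm \<rho> (S z (\<lambda>y. (-1) * g y + f y)) = 0"
      using B'[OF h, of z] X_norm_nonneg[of "S z (\<lambda>y. (-1) * g y + f y)"] by simp
    then have "AE x in M. S z (\<lambda>y. (-1) * g y + f y) x = 0"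
      using X_norm_zero[OF SX[OF h]] by auto
    with Slin[OF g f, of z "-1"] show ?thesis by auto
  qed
  \<comment> \<open>Apply \<open>S z\<close> to the identity
    \<open>z * S w f - T (S w f) = (z - w) * S w f + f\<close>.\<close>
  have resolvent: "AE x in M. S w f x = (z - w) * S z (S w f) x + S z f x"
    if f: "f \<in> X_space M \<rho>" for f z w
  proof -
    note u = SX[OF f, of w]
    have "(\<lambda>x. z * S w f x + (-1 * T (S w f) x + 0)) \<in> X_space M \<rho>"
      by (intro X_space_lincomb u TX X_space_const)
    then have 1: "(\<lambda>x. z * S w f x - T (S w f) x) \<in> X_space M \<rho>" by simp
    have 2: "(\<lambda>x. (z - w) * S w f x + f x) \<in> X_space M \<rho>" by (intro X_space_lincomb u f)
    have "AE x in M. z * S w f x - T (S w f) x = (z - w) * S w f x + f x"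
      using AS[OF f, of w] by eventually_elim (auto simp: algebra_simps)
    from Scong[OF 1 2 this, of z] SA[OF u, of z] Slin[OF u f, of z "z - w"]
    show ?thesis by eventually_elim simp
  qed
  \<comment> \<open>The norm of \<open>S w f\<close> stands on both sides while only the bound of
    \<open>S z\<close> enters. For \<open>w\<close> near \<open>z\<close> it can be absorbed on the
    left, which bounds \<open>S w f\<close> uniformly although \<open>B'\<close> may be irregular in
    \<open>w\<close>.\<close>
  have resolvent_norm: "X_norm \<rho> (S w f) \<le> cmod (z - w) * B' z * X_norm \<rho> (S w f) + B' z * X_norm \<rho> f"
    if f: "f \<in> X_space M \<rho>" for f z w
  proof -
    have "X_norm \<rho> (S w f) = X_norm \<rho> (\<lambda>x. (z - w) * S z (S w f) x + S z f x)"
      by (intro X_norm_cong resolvent X_spaceD X_space_lincomb SX f)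
    also have "\<dots> \<le> cmod (z - w) * X_norm \<rho> (S z (S w f)) + X_norm \<rho> (S z f)"
      by (intro X_norm_lincomb SX f)
    also have "\<dots> \<le> cmod (z - w) * (B' z * X_norm \<rho> (S w f)) + B' z * X_norm \<rho> f"
      by (intro add_mono mult_left_mono B' SX f) auto
    finally show ?thesis by simp
  qed
  define e :: "'a \<Rightarrow> complex" where "e = (\<lambda>_. 1)"
  have e: "e \<in> X_space M \<rho>" unfolding e_def by (rule X_space_const)
  define F where "F z = (\<integral>x. S z e x \<partial>M)" for z
  have Fdiff: "F w - F z = (z - w) * (\<integral>x. S z (S w e) x \<partial>M)" for w z
  proof -
    have "F w = (\<integral>x. (z - w) * S z (S w e) x + S z e x \<partial>M)"
      unfolding F_def by (intro integral_cong_AE resolvent X_spaceD X_space_lincomb SX e)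
    also have "\<dots> = (z - w) * (\<integral>x. S z (S w e) x \<partial>M) + F z"
      unfolding F_def by (intro int_lin SX e)
    finally show ?thesis by simp
  qed
  \<comment> \<open>A second use of the resolvent identity: it measures how far the difference
    quotient of \<open>F\<close> is from the candidate derivative.\<close>
  have Fdiff2: "(\<integral>x. S z (S w e) x \<partial>M) - (\<integral>x. S z (S z e) x \<partial>M)
      = (z - w) * (\<integral>x. S z (S z (S w e)) x \<partial>M)" for w z
  proof -
    have "AE x in M. S z (S w e) x = S z (\<lambda>x. (z - w) * S z (S w e) x + S z e x) x"
      by (intro Scong resolvent X_space_lincomb SX e)
    moreover have "AE x in M. S z (\<lambda>x. (z - w) * S z (S w e) x + S z e x) x
         = (z - w) * S z (S z (S w e)) x + S z (S z e) x"
      by (intro Slin SX e)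
    ultimately have *: "AE x in M. S z (S w e) x = (z - w) * S z (S z (S w e)) x + S z (S z e) x"
      by eventually_elim simp
    have "(\<integral>x. S z (S w e) x \<partial>M) = (\<integral>x. (z - w) * S z (S z (S w e)) x + S z (S z e) x \<partial>M)"
      by (intro integral_cong_AE * X_spaceD X_space_lincomb SX e)
    also have "\<dots> = (z - w) * (\<integral>x. S z (S z (S w e)) x \<partial>M) + (\<integral>x. S z (S z e) x \<partial>M)"
      by (intro int_lin SX e)
    finally show ?thesis by simp
  qed
  have "(F has_field_derivative - (\<integral>x. S z (S z e) x \<partial>M)) (at z)" for z
  proof -
    \<comment> \<open>\<open>K\<close> comes from the integral, each of the two outer
      \<open>S z\<close> gives a factor \<open>B' z\<close>, and the innermost \<open>S w e\<close>
      is bounded by \<open>2 * B' z * X_norm \<rho> e\<close> through absorption.\<close>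
    define Q where "Q = K * (B' z * (B' z * (2 * B' z * X_norm \<rho> e)))"
    have quot: "cmod ((F w - F z) / (w - z) - - (\<integral>x. S z (S z e) x \<partial>M)) \<le> Q * cmod (w - z)"
      if w: "w \<noteq> z" "cmod (w - z) < 1 / (2 * B' z)" for w
    proof -
      have bnd: "X_norm \<rho> (S w e) \<le> 2 * B' z * X_norm \<rho> e"
      proof -
        have "cmod (z - w) * B' z \<le> 1 / 2"
          using w(2) B'1[of z] by (simp add: norm_minus_commute field_simps)
        then have "cmod (z - w) * B' z * X_norm \<rho> (S w e) \<le> 1 / 2 * X_norm \<rho> (S w e)"
          by (intro mult_right_mono X_norm_nonneg)
        then show ?thesis using resolvent_norm[OF e, of w z] by simp
      qed
      have "(F w - F z) / (w - z) = - (\<integral>x. S z (S w e) x \<partial>M)"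
        using w unfolding Fdiff by (simp add: field_simps)
      then have "(F w - F z) / (w - z) - - (\<integral>x. S z (S z e) x \<partial>M)
          = (w - z) * (\<integral>x. S z (S z (S w e)) x \<partial>M)"
        using Fdiff2[of z w] by (simp add: algebra_simps)
      then have eq: "cmod ((F w - F z) / (w - z) - - (\<integral>x. S z (S z e) x \<partial>M))
          = cmod (w - z) * cmod (\<integral>x. S z (S z (S w e)) x \<partial>M)"
        by (simp add: norm_mult)
      have "cmod (\<integral>x. S z (S z (S w e)) x \<partial>M) \<le> K * X_norm \<rho> (S z (S z (S w e)))"
        by (intro K SX e)
      also have "\<dots> \<le> K * (B' z * X_norm \<rho> (S z (S w e)))"
        using K(1) by (intro mult_left_mono B' SX e) auto
      also have "\<dots> \<le> K * (B' z * (B' z * X_norm \<rho> (S w e)))"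
        using K(1) B'1[of z] by (intro mult_left_mono B' SX e) auto
      also have "K * (B' z * (B' z * X_norm \<rho> (S w e))) \<le> Q"
        unfolding Q_def using K(1) B'1[of z] by (intro mult_left_mono bnd) auto
      finally show ?thesis unfolding eq by (subst mult.commute) (auto intro: mult_right_mono)
    qed
    have "((\<lambda>w. (F w - F z) / (w - z) - - (\<integral>x. S z (S z e) x \<partial>M)) \<longlongrightarrow> 0) (at z)"
    proof (rule Lim_null_comparison)
      show "\<forall>\<^sub>F w in at z. cmod ((F w - F z) / (w - z) - - (\<integral>x. S z (S z e) x \<partial>M)) \<le> Q * cmod (w - z)"
        unfolding eventually_at using B'1[of z]
        by (intro exI[of _ "1 / (2 * B' z)"] conjI ballI impI quot) (auto simp: dist_norm)
      show "((\<lambda>w. Q * cmod (w - z)) \<longlongrightarrow> 0) (at z)"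
        by (auto intro!: tendsto_eq_intros)
    qed
    then show ?thesis unfolding has_field_derivative_iff using LIM_zero_iff by blast
  qed
  then have hol: "F holomorphic_on UNIV"
    by (meson UNIV_I holomorphic_on_open open_UNIV)
  define C' where "C' = max 1 C"
  have C': "C' \<ge> 1" by (simp add: C'_def)
  have TC': "X_norm \<rho> (T f) \<le> C' * X_norm \<rho> f" if "f \<in> X_space M \<rho>" for f
    using Tbd[OF that] mult_right_mono[of C C' "X_norm \<rho> f"] X_norm_nonneg[of f]
    by (auto simp: C'_def)
  \<comment> \<open>In \<open>z * S z e = T (S z e) + e\<close>, the condition on \<open>z\<close>
    gives the term with \<open>T\<close> a coefficient of at most 1/2 after division by
    \<open>z\<close>, so it can be absorbed.\<close>
  have Sdecay: "X_norm \<rho> (S z e) \<le> 2 * X_norm \<rho> e / cmod z" if z: "cmod z \<ge> 2 * C'" for z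
  proof -
    have z0: "z \<noteq> 0" using z C' by auto
    have ae: "AE x in M. S z e x = (1/z) * T (S z e) x + ((1/z) * e x + 0)"
      using AS[OF e, of z] by eventually_elim (use z0 in \<open>simp add: field_simps\<close>)
    have "X_norm \<rho> (S z e) = X_norm \<rho> (\<lambda>x. (1/z) * T (S z e) x + ((1/z) * e x + 0))"
      by (intro X_norm_cong ae X_spaceD X_space_lincomb X_space_const TX SX e)
    also have "\<dots> \<le> cmod (1/z) * X_norm \<rho> (T (S z e)) + X_norm \<rho> (\<lambda>x. (1/z) * e x + 0)"
      by (intro X_norm_lincomb X_space_lincomb X_space_const TX SX e)
    also have "X_norm \<rho> (\<lambda>x. (1/z) * e x + 0) \<le> cmod (1/z) * X_norm \<rho> e + X_norm \<rho> (\<lambda>_. 0)"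
      by (intro X_norm_lincomb X_space_const e)
    also have "X_norm \<rho> (\<lambda>_. 0) = 0" using X_norm_zero[OF X_space_const[of 0]] by simp
    also have "cmod (1/z) * X_norm \<rho> (T (S z e)) \<le> cmod (1/z) * (C' * X_norm \<rho> (S z e))"
      by (intro mult_left_mono TC' SX e) auto
    also have "cmod (1/z) * (C' * X_norm \<rho> (S z e)) \<le> 1/2 * X_norm \<rho> (S z e)"
    proof -
      have "cmod (1/z) * C' \<le> 1/2" using z z0 C' by (simp add: norm_divide field_simps)
      from mult_right_mono[OF this X_norm_nonneg[of "S z e"]] show ?thesis by simp
    qed
    finally show ?thesis by (simp add: norm_divide)
  qed
  have lim_const: "((\<lambda>z. a / cmod z) \<longlongrightarrow> 0) at_infinity" for a
    by (intro tendsto_divide_0[OF tendsto_const] filterlim_at_top_imp_at_infinity filterlim_norm_at_top)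
  have big: "\<forall>\<^sub>F z in at_infinity. cmod z \<ge> 2 * C'"
    unfolding eventually_at_infinity by blast
  have F0: "(F \<longlongrightarrow> 0) at_infinity"
  proof (rule Lim_null_comparison[OF _ lim_const])
    show "\<forall>\<^sub>F z in at_infinity. cmod (F z) \<le> K * (2 * X_norm \<rho> e) / cmod z"
      using big
    proof eventually_elim
      case (elim z)
      have "cmod (F z) \<le> K * X_norm \<rho> (S z e)" unfolding F_def by (intro K SX e)
      also have "\<dots> \<le> K * (2 * X_norm \<rho> e / cmod z)"
        using K(1) by (intro mult_left_mono Sdecay elim) auto
      finally show ?case by simp
    qed
  qed
  have Fz: "F z = 0" for z using Liouville_weak[OF hol F0] .
  \<comment> \<open>The difference is the integral of \<open>T (S z e)\<close>, which decays like
    \<open>S z e\<close>. As \<open>F\<close> vanishes identically, the total mass itself must be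
    0.\<close>
  have "((\<lambda>z. z * F z - (\<integral>x. e x \<partial>M)) \<longlongrightarrow> 0) at_infinity"
  proof (rule Lim_null_comparison[OF _ lim_const])
    show "\<forall>\<^sub>F z in at_infinity. cmod (z * F z - (\<integral>x. e x \<partial>M)) \<le> K * (C' * (2 * X_norm \<rho> e)) / cmod z"
      using big
    proof eventually_elim
      case (elim z)
      have "z * F z - (\<integral>x. e x \<partial>M) = (\<integral>x. z * S z e x - e x \<partial>M)"
        unfolding F_def by (simp add: K(2)[OF SX[OF e]] K(2)[OF e])
      also have "\<dots> = (\<integral>x. T (S z e) x \<partial>M)"
      proof (rule integral_cong_AE)
        show "AE x in M. z * S z e x - e x = T (S z e) x"
          using AS[OF e, of z] by eventually_elim (auto simp: algebra_simps)
        have "(\<lambda>x. z * S z e x + ((-1) * e x + 0)) \<in> X_space M \<rho>"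
          by (intro X_space_lincomb SX e X_space_const)
        then show "(\<lambda>x. z * S z e x - e x) \<in> borel_measurable M" by (simp add: X_spaceD)
      qed (intro X_spaceD TX SX e)
      finally have "cmod (z * F z - (\<integral>x. e x \<partial>M)) \<le> K * X_norm \<rho> (T (S z e))"
        using K(3)[OF TX[OF SX[OF e]]] by simp
      also have "\<dots> \<le> K * (C' * X_norm \<rho> (S z e))"
        using K(1) by (intro mult_left_mono TC' SX e) auto
      also have "\<dots> \<le> K * (C' * (2 * X_norm \<rho> e / cmod z))"
        using K(1) C' by (intro mult_left_mono Sdecay elim) auto
      finally show ?case by simp
    qed
  qed
  then have "((\<lambda>z::complex. - (\<integral>x. e x \<partial>M)) \<longlongrightarrow> 0) at_infinity" by (simp add: Fz)
  from tendsto_unique[OF trivial_limit_at_infinity this tendsto_const]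
  have "(\<integral>x. e x \<partial>M) = 0" by simp
  then show False using M0 by (simp add: e_def)
qed

text \<open>The inverse is the series with terms \<open>u f n\<close>, the \<open>n\<close>-th
  iterate applied to \<open>f\<close> and divided by \<open>z ^ Suc n\<close>. Summable bounds make
  the series of moduli finite almost everywhere, so pointwise summation defines the inverse; what
  \<open>suminf\<close> returns on the exceptional null set does not matter.\<close>

lemma neumann_series_invertible:
  fixes g :: "'a \<Rightarrow> complex" and \<alpha> :: "'a \<Rightarrow> 'a" and z :: complex and c :: "nat \<Rightarrow> real"
  assumes g [measurable]: "g \<in> borel_measurable M" and \<alpha> [measurable]: "\<alpha> \<in> measurable M M"
    and z: "z \<noteq> 0" and c0: "\<And>n. c n \<ge> 0" and sm: "summable (\<lambda>n. c n / cmod z ^ Suc n)"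
    and bd: "\<And>n f. f \<in> borel_measurable M \<Longrightarrow> \<rho> f < \<infinity> \<Longrightarrow>
        \<rho> (\<lambda>x. ennreal (cmod (\<Prod>j<n. g ((\<alpha> ^^ j) x))) * f ((\<alpha> ^^ n) x)) \<le> ennreal (c n) * \<rho> f"
  shows "bounded_invertible_on M \<rho> (\<lambda>f x. z * f x - g x * f (\<alpha> x))"
proof -
  have \<alpha>n [measurable]: "(\<alpha> ^^ n) \<in> measurable M M" for n
    by (induction n) (auto intro: measurable_comp \<alpha>)
  define u where "u f n x = (\<Prod>j<n. g ((\<alpha> ^^ j) x)) * f ((\<alpha> ^^ n) x) / z ^ Suc n" for f :: "'a \<Rightarrow> complex" and n x
  define S where "S f x = (\<Sum>n. u f n x)" for f x
  define C where "C = (\<Sum>n. c n / cmod z ^ Suc n)"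
  have C0: "C \<ge> 0" unfolding C_def by (intro suminf_nonneg sm) (auto simp: c0)
  have um [measurable]: "u f n \<in> borel_measurable M" if [measurable]: "f \<in> borel_measurable M" for f n
    unfolding u_def by measurable
  have Sm: "S f \<in> borel_measurable M" if "f \<in> borel_measurable M" for f
    unfolding S_def using um[OF that] by measurable
  have total: "\<rho> (\<lambda>x. \<Sum>n. ennreal (cmod (u f n x))) \<le> ennreal (C * X_norm \<rho> f)"
    if f: "f \<in> X_space M \<rho>" for f
  proof -
    note [measurable] = X_spaceD(1)[OF f]
    have "\<rho> (\<lambda>x. \<Sum>n. ennreal (cmod (u f n x))) \<le> (\<Sum>n. \<rho> (\<lambda>x. ennreal (cmod (u f n x))))"
      by (rule rho_suminf) measurable
    also have "\<dots> \<le> (\<Sum>n. ennreal (c n / cmod z ^ Suc n * X_norm \<rho> f))"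
    proof (rule suminf_le)
      fix n
      have "\<rho> (\<lambda>x. ennreal (cmod (u f n x))) = \<rho> (\<lambda>x. ennreal (1 / cmod z ^ Suc n) *
          (ennreal (cmod (\<Prod>j<n. g ((\<alpha> ^^ j) x))) * ennreal (cmod (f ((\<alpha> ^^ n) x)))))"
        by (intro arg_cong[of _ _ \<rho>] ext)
          (auto simp: u_def norm_mult norm_divide norm_power ennreal_mult[symmetric])
      also have "\<dots> = ennreal (1 / cmod z ^ Suc n) *
          \<rho> (\<lambda>x. ennreal (cmod (\<Prod>j<n. g ((\<alpha> ^^ j) x))) * ennreal (cmod (f ((\<alpha> ^^ n) x))))"
        by (rule rho_scale) auto
      also have "\<dots> \<le> ennreal (1 / cmod z ^ Suc n) * (ennreal (c n) * \<rho> (\<lambda>x. ennreal (cmod (f x))))"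
        using f by (intro mult_left_mono bd) (auto simp: X_space_def)
      also have "\<dots> = ennreal (c n / cmod z ^ Suc n * X_norm \<rho> f)"
        by (simp add: X_spaceD(2)[OF f] ennreal_mult[symmetric] X_norm_nonneg c0 del: power_Suc)
      finally show "\<rho> (\<lambda>x. ennreal (cmod (u f n x))) \<le> ennreal (c n / cmod z ^ Suc n * X_norm \<rho> f)" .
    qed auto
    also have "\<dots> = ennreal (\<Sum>n. c n / cmod z ^ Suc n * X_norm \<rho> f)"
    proof (rule suminf_ennreal2)
      show "summable (\<lambda>n. c n / cmod z ^ Suc n * X_norm \<rho> f)" by (rule summable_mult2[OF sm])
    qed (auto simp: c0 X_norm_nonneg)
    also have "(\<Sum>n. c n / cmod z ^ Suc n * X_norm \<rho> f) = C * X_norm \<rho> f"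
      unfolding C_def by (rule suminf_mult2[OF sm, symmetric])
    finally show ?thesis .
  qed
  have ae: "AE x in M. summable (\<lambda>n. cmod (u f n x))" if f: "f \<in> X_space M \<rho>" for f
  proof -
    note [measurable] = X_spaceD(1)[OF f]
    have "AE x in M. (\<Sum>n. ennreal (cmod (u f n x))) < \<infinity>"
      using total[OF f] by (intro AE_finite_of_rho_finite) (auto intro: le_less_trans)
    then show ?thesis
      by eventually_elim (auto intro: summable_suminf_not_top)
  qed
  have Sbd: "\<rho> (\<lambda>x. ennreal (cmod (S f x))) \<le> ennreal (C * X_norm \<rho> f)" if f: "f \<in> X_space M \<rho>" for f
  proof -
    note [measurable] = X_spaceD(1)[OF f] Sm[OF X_spaceD(1)[OF f]]
    have "AE x in M. ennreal (cmod (S f x)) \<le> (\<Sum>n. ennreal (cmod (u f n x)))"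
      using ae[OF f]
    proof eventually_elim
      case (elim x)
      then have "(\<Sum>n. ennreal (cmod (u f n x))) = ennreal (\<Sum>n. cmod (u f n x))"
        by (intro suminf_ennreal2) auto
      then show ?case unfolding S_def using summable_norm[OF elim] by (simp add: ennreal_leI)
    qed
    then have "\<rho> (\<lambda>x. ennreal (cmod (S f x))) \<le> \<rho> (\<lambda>x. \<Sum>n. ennreal (cmod (u f n x)))"
      by (intro rho_mono) auto
    then show ?thesis using total[OF f] by (rule order_trans)
  qed
  have SX: "S f \<in> X_space M \<rho>" and SC: "X_norm \<rho> (S f) \<le> C * X_norm \<rho> f" if f: "f \<in> X_space M \<rho>" for f
    using X_norm_leI[OF Sm[OF X_spaceD(1)[OF f]] Sbd[OF f]] C0 by (auto simp: X_norm_nonneg)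
  have Slin: "AE x in M. S (\<lambda>y. a * f y + h y) x = a * S f x + S h x"
    if f: "f \<in> X_space M \<rho>" and h: "h \<in> X_space M \<rho>" for f h a
    using ae[OF f] ae[OF h]
  proof eventually_elim
    case (elim x)
    have "u (\<lambda>y. a * f y + h y) n x = a * u f n x + u h n x" for n
      unfolding u_def by (simp only: distrib_left add_divide_distrib mult.left_commute times_divide_eq_right)
    then have "S (\<lambda>y. a * f y + h y) x = (\<Sum>n. a * u f n x + u h n x)"
      unfolding S_def by simp
    also have "\<dots> = (\<Sum>n. a * u f n x) + (\<Sum>n. u h n x)"
      using elim[THEN summable_norm_cancel] by (intro suminf_add[symmetric] summable_mult)
    also have "(\<Sum>n. a * u f n x) = a * S f x"
      unfolding S_def using elim(1)[THEN summable_norm_cancel] by (rule suminf_mult)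
    finally show ?case by (simp add: S_def)
  qed
  \<comment> \<open>The terms for \<open>z * f - gWf\<close> are
    \<open>z * (u f n - u f (Suc n))\<close>, so the series telescopes to \<open>z * u f 0\<close>,
    which is \<open>f\<close>.\<close>
  have SA: "AE x in M. S (\<lambda>x. z * f x - g x * f (\<alpha> x)) x = f x" if f: "f \<in> X_space M \<rho>" for f
    using ae[OF f]
  proof eventually_elim
    case (elim x)
    then have s: "summable (\<lambda>n. u f n x)" by (rule summable_norm_cancel)
    have "u (\<lambda>x. z * f x - g x * f (\<alpha> x)) n x = z * (u f n x - u f (Suc n) x)" for n
      unfolding u_def using z by (simp add: field_simps)
    moreover have "(\<lambda>n. u f n x - u f (Suc n) x) sums (u f 0 x - 0)"
      by (rule telescope_sums') (rule summable_LIMSEQ_zero[OF s])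
    ultimately have "(\<lambda>n. u (\<lambda>x. z * f x - g x * f (\<alpha> x)) n x) sums (z * u f 0 x)"
      by (auto dest: sums_mult)
    then show ?case unfolding S_def using z by (simp add: sums_iff u_def)
  qed
  have AS: "AE x in M. z * S f x - g x * S f (\<alpha> x) = f x" if f: "f \<in> X_space M \<rho>" for f
    using ae[OF f]
  proof eventually_elim
    case (elim x)
    then have s: "summable (\<lambda>n. u f n x)" by (rule summable_norm_cancel)
    have s': "summable (\<lambda>n. u f (Suc n) x)"
      using s summable_Suc_iff[of "\<lambda>n. u f n x"] by simp
    have shift: "g x * u f n (\<alpha> x) = z * u f (Suc n) x" for n
      unfolding u_def using z
      by (simp add: prod.lessThan_Suc_shift funpow_swap1 field_simps del: prod.lessThan_Suc)
    have "g x * S f (\<alpha> x) = (\<Sum>n. g x * u f n (\<alpha> x))"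
    \<comment> \<open>Convergence at \<alpha>\<open>x\<close> is inferred from convergence at
      \<open>x\<close>, which is possible exactly when \<open>g x\<close> can be divided out. If
      \<open>g x = 0\<close> both sides vanish, whatever value \<open>suminf\<close> takes. So it
      never has to be known that \<alpha> pulls null sets back to null sets.\<close>
    proof (cases "g x = 0")
      case False
      have "summable (\<lambda>n. g x * u f n (\<alpha> x))"
        unfolding shift by (rule summable_mult[OF s'])
      with False have "summable (\<lambda>n. u f n (\<alpha> x))" by (simp add: summable_cmult_iff)
      then show ?thesis unfolding S_def by (rule suminf_mult[symmetric])
    qed simp
    also have "\<dots> = z * (\<Sum>n. u f (Suc n) x)"
      unfolding shift by (rule suminf_mult[OF s'])
    also have "(\<Sum>n. u f (Suc n) x) = S f x - u f 0 x"
      unfolding S_def using suminf_split_head[OF s] by simp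
    finally show ?case using z by (simp add: u_def algebra_simps)
  qed
  show ?thesis
    unfolding bounded_invertible_on_def
    by (rule exI[of _ S]) (use SX SC Slin SA AS in blast)
qed

end

section \<open>Arc-length measure and decreasing rearrangement\<close>

locale jordan_curve =
  fixes \<gamma> :: "real \<Rightarrow> complex" and L :: real
  assumes curve: "smooth_jordan_curve \<gamma> L"
begin

abbreviation "\<Gamma> \<equiv> curve_set \<gamma> L"
abbreviation "M \<equiv> arc_measure \<gamma> L"
abbreviation "coord \<equiv> arc_coord \<gamma> L"

lemma L_pos: "0 < L" and periodic: "\<gamma> (s + L) = \<gamma> s" and inj: "inj_on \<gamma> {0..<L}"
  using curve unfolding smooth_jordan_curve_def by auto

lemma tangent:
  "\<exists>\<gamma>'. (\<forall>s. (\<gamma> has_vector_derivative \<gamma>' s) (at s)) \<and> continuous_on UNIV \<gamma>' \<and> (\<forall>s. norm (\<gamma>' s) = 1)"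
  using curve unfolding smooth_jordan_curve_def by blast

lemma cont: "continuous_on A \<gamma>"
proof -
  obtain \<gamma>' where "\<forall>s. (\<gamma> has_vector_derivative \<gamma>' s) (at s)" using tangent by blast
  then have "isCont \<gamma> s" for s using has_vector_derivative_continuous by blast
  then show ?thesis by (simp add: continuous_at_imp_continuous_on)
qed

lemma periodic_int: "\<gamma> (s + of_int k * L) = \<gamma> s"
proof -
  have nat: "\<gamma> (s + real n * L) = \<gamma> s" for n s
    by (induction n) (use periodic in \<open>auto simp: algebra_simps\<close>, metis add.assoc add.commute periodic)
  show ?thesis
  proof (cases "k \<ge> 0")
    case True
    then show ?thesis using nat[of s "nat k"] by simp
  next
    case False
    then show ?thesis using nat[of "s + of_int k * L" "nat (-k)"] by simp
  qed
qed

lemma reduce_period: obtains k :: int where "s + of_int k * L \<in> {0..<L}"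
proof
  have 1: "of_int \<lfloor>s / L\<rfloor> * L \<le> s" using L_pos by (simp add: pos_le_divide_eq[symmetric])
  have "s / L < of_int \<lfloor>s / L\<rfloor> + 1" by linarith
  then have 2: "s < (of_int \<lfloor>s / L\<rfloor> + 1) * L" by (simp only: pos_divide_less_eq[OF L_pos])
  show "s + of_int (- \<lfloor>s / L\<rfloor>) * L \<in> {0..<L}" using 1 2 by (simp add: algebra_simps)
qed

lemma gamma_eqD: assumes "\<gamma> s = \<gamma> t" obtains k :: int where "t = s + of_int k * L"
proof -
  obtain k where k: "s + of_int k * L \<in> {0..<L}" by (rule reduce_period)
  obtain l where l: "t + of_int l * L \<in> {0..<L}" by (rule reduce_period)
  have "s + of_int k * L = t + of_int l * L"
    by (rule inj_onD[OF inj _ k l]) (simp add: periodic_int assms)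
  then have "t = s + of_int (k - l) * L" by (simp add: algebra_simps)
  then show thesis using that by blast
qed

lemma gamma_in: "\<gamma> s \<in> \<Gamma>"
proof -
  obtain k where "s + of_int k * L \<in> {0..<L}" by (rule reduce_period)
  then have "\<gamma> (s + of_int k * L) \<in> \<gamma> ` {0..L}" by (intro imageI) simp
  then show ?thesis by (simp only: curve_set_def periodic_int)
qed

lemma curve_set_eq: "\<Gamma> = \<gamma> ` {0..<L}"
proof (intro equalityI subsetI)
  fix x assume "x \<in> \<Gamma>"
  then obtain s where s: "x = \<gamma> s" unfolding curve_set_def by auto
  obtain k where k: "s + of_int k * L \<in> {0..<L}" by (rule reduce_period)
  with s show "x \<in> \<gamma> ` {0..<L}" by (intro image_eqI[OF _ k]) (simp add: periodic_int)
qed (auto intro: gamma_in)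

lemma compact_curve: "compact \<Gamma>"
  unfolding curve_set_def by (intro compact_continuous_image cont compact_Icc)

lemma coord_gamma: "s \<in> {0..<L} \<Longrightarrow> coord (\<gamma> s) = s"
  unfolding arc_coord_def by (rule the_inv_into_f_f[OF inj])

lemma gamma_coord: "\<tau> \<in> \<Gamma> \<Longrightarrow> \<gamma> (coord \<tau>) = \<tau>"
  and coord_in: "\<tau> \<in> \<Gamma> \<Longrightarrow> coord \<tau> \<in> {0..<L}"
  unfolding curve_set_eq by (auto simp: coord_gamma)

lemma space_M [simp]: "space M = \<Gamma>"
  unfolding arc_measure_def by (simp add: space_restrict_space)

lemma sets_M [measurable_cong]: "sets M = sets (restrict_space borel \<Gamma>)"
  unfolding arc_measure_def by simp

lemma gamma_measurable: "\<gamma> \<in> measurable (restrict_space lborel {0..<L}) (restrict_space borel \<Gamma>)"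
proof (rule measurable_restrict_space2)
  have "\<gamma> \<in> borel_measurable borel" by (intro borel_measurable_continuous_onI cont)
  then show "\<gamma> \<in> borel_measurable (restrict_space lborel {0..<L})"
    by (intro measurable_restrict_space1) simp
qed (simp add: gamma_in)

lemma gamma_measurable_borel: "\<gamma> \<in> measurable borel M"
proof -
  have "\<gamma> \<in> measurable borel (restrict_space borel \<Gamma>)"
    by (rule measurable_restrict_space2) (auto simp: gamma_in intro: borel_measurable_continuous_onI cont)
  then show ?thesis unfolding measurable_cong_sets[OF refl sets_M] .
qed

lemma nn_integral_M:
  assumes "F \<in> borel_measurable M"
  shows "(\<integral>\<^sup>+x. F x \<partial>M) = (\<integral>\<^sup>+s. F (\<gamma> s) * indicator {0..<L} s \<partial>lborel)"
proof -
  have "(\<integral>\<^sup>+x. F x \<partial>M) = (\<integral>\<^sup>+s. F (\<gamma> s) \<partial>restrict_space lborel {0..<L})"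
    unfolding arc_measure_def using assms
    by (intro nn_integral_distr gamma_measurable) (simp add: arc_measure_def)
  also have "\<dots> = (\<integral>\<^sup>+s. F (\<gamma> s) * indicator {0..<L} s \<partial>lborel)"
    by (rule nn_integral_restrict_space) simp
  finally show ?thesis .
qed

lemma emeasure_M:
  assumes "A \<in> sets M"
  shows "emeasure M A = emeasure lborel {s\<in>{0..<L}. \<gamma> s \<in> A}"
proof -
  have "emeasure M A = emeasure (restrict_space lborel {0..<L}) (\<gamma> -` A \<inter> {0..<L})"
    unfolding arc_measure_def using assms gamma_measurable
    by (subst emeasure_distr) (auto simp: sets_M space_restrict_space)
  also have "\<dots> = emeasure lborel (\<gamma> -` A \<inter> {0..<L})"
    by (rule emeasure_restrict_space) auto
  also have "\<gamma> -` A \<inter> {0..<L} = {s\<in>{0..<L}. \<gamma> s \<in> A}" by auto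
  finally show ?thesis .
qed

lemma emeasure_curve: "emeasure M \<Gamma> = ennreal L"
proof -
  have "emeasure M \<Gamma> = emeasure lborel {s\<in>{0..<L}. \<gamma> s \<in> \<Gamma>}"
    using sets.top[of M] by (intro emeasure_M) simp
  also have "{s\<in>{0..<L}. \<gamma> s \<in> \<Gamma>} = {0..<L}" by (auto simp: gamma_in)
  finally show ?thesis using L_pos by simp
qed

sublocale finite_measure M
  by standard (simp add: emeasure_curve)

lemma measure_curve: "measure M \<Gamma> = L"
  using L_pos by (simp add: measure_def emeasure_curve)

lemma coord_measurable [measurable]: "coord \<in> borel_measurable M"
proof (rule borel_measurableI_le)
  fix y :: real
  show "{x \<in> space M. coord x \<le> y} \<in> sets M"
  proof (cases "y < L")
    case True
    have eq: "{x \<in> space M. coord x \<le> y} = \<gamma> ` {0..y} \<inter> \<Gamma>"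
    proof (intro equalityI subsetI)
      fix x assume "x \<in> {x \<in> space M. coord x \<le> y}"
      then have x: "x \<in> \<Gamma>" "coord x \<le> y" by auto
      have "\<gamma> (coord x) \<in> \<gamma> ` {0..y}" using x coord_in[OF x(1)] by (intro imageI) simp
      then show "x \<in> \<gamma> ` {0..y} \<inter> \<Gamma>" using x by (simp add: gamma_coord)
    qed (use True in \<open>auto simp: coord_gamma\<close>)
    have "closed (\<gamma> ` {0..y})" by (intro compact_imp_closed compact_continuous_image cont compact_Icc)
    then have b: "\<gamma> ` {0..y} \<in> sets borel" by (rule borel_closed)
    show ?thesis unfolding eq sets_M sets_restrict_space
      by (rule image_eqI[OF _ b]) (rule Int_commute)
  next
    case False
    have "coord x \<le> y" if "x \<in> \<Gamma>" for x using coord_in[OF that] False by simp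
    then have "{x \<in> space M. coord x \<le> y} = space M" by auto
    then show ?thesis by (simp only: sets.top)
  qed
qed

lemma compose_coord_measurable:
  fixes h :: "real \<Rightarrow> ennreal"
  assumes h: "h \<in> borel_measurable (restrict_space lborel {0..L})"
  shows "(\<lambda>\<tau>. h (coord \<tau>)) \<in> borel_measurable M"
proof (rule measurable_compose[OF _ h])
  show "coord \<in> measurable M (restrict_space lborel {0..L})"
  proof (rule measurable_restrict_space2)
    show "coord \<in> space M \<rightarrow> {0..L}" using coord_in less_imp_le[of _ L] by fastforce
  qed (use coord_measurable in simp)
qed

lemma emeasure_compose_coord:
  fixes h :: "real \<Rightarrow> ennreal"
  assumes h: "h \<in> borel_measurable (restrict_space lborel {0..L})"
  shows "emeasure M {\<tau>\<in>space M. h (coord \<tau>) > a} = emeasure lborel {s\<in>{0..<L}. h s > a}"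
proof -
  note [measurable] = compose_coord_measurable[OF h]
  have "emeasure M {\<tau>\<in>space M. h (coord \<tau>) > a}
      = emeasure lborel {s\<in>{0..<L}. \<gamma> s \<in> {\<tau>\<in>space M. h (coord \<tau>) > a}}"
    by (rule emeasure_M) measurable
  also have "{s\<in>{0..<L}. \<gamma> s \<in> {\<tau>\<in>space M. h (coord \<tau>) > a}} = {s\<in>{0..<L}. h s > a}"
    by (auto simp: coord_gamma gamma_in)
  finally show ?thesis .
qed

end

section \<open>Distribution functions and the decreasing rearrangement on a general measure
  space\<close>

definition distribution_fun :: "'a measure \<Rightarrow> ('a \<Rightarrow> ennreal) \<Rightarrow> real \<Rightarrow> ennreal" where
  "distribution_fun M v t = emeasure M {x\<in>space M. v x > ennreal t}"

text \<open>The decreasing rearrangement, written as a supremum of exceeded levels instead of the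
  usual infimum, so that strict superlevel sets translate directly. An empty set of levels gives
  0.\<close>

definition rearrangement :: "'a measure \<Rightarrow> ('a \<Rightarrow> ennreal) \<Rightarrow> real \<Rightarrow> ennreal" where
  "rearrangement M v s = Sup {ennreal t |t. t \<ge> 0 \<and> distribution_fun M v t > ennreal s}"

lemma distribution_fun_antimono:
  assumes [measurable]: "v \<in> borel_measurable M" and "s \<le> t"
  shows "distribution_fun M v t \<le> distribution_fun M v s"
  unfolding distribution_fun_def
  by (rule emeasure_mono) (use assms(2) in \<open>auto intro: le_less_trans[OF ennreal_leI]\<close>)

text \<open>One direction is antitonicity of the distribution function. The other is its
  right-continuity: the sets \<open>A n\<close> increase to the superlevel set at \<open>t\<close>,
  so some level slightly above \<open>t\<close> still has measure larger than
  \<open>s\<close>.\<close>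

lemma rearrangement_gt_iff:
  assumes v [measurable]: "v \<in> borel_measurable M" and t: "t \<ge> 0"
  shows "rearrangement M v s > ennreal t \<longleftrightarrow> distribution_fun M v t > ennreal s"
proof
  assume "rearrangement M v s > ennreal t"
  then obtain t' where t': "ennreal t' > ennreal t" "t' \<ge> 0" "distribution_fun M v t' > ennreal s"
    unfolding rearrangement_def less_Sup_iff by auto
  then have "t \<le> t'" using t by (simp add: ennreal_less_iff)
  from distribution_fun_antimono[OF v this] t'(3) show "distribution_fun M v t > ennreal s"
    by (rule less_le_trans[rotated])
next
  assume *: "distribution_fun M v t > ennreal s"
  define A where "A n = {x\<in>space M. v x > ennreal (t + 1 / Suc n)}" for n
  have "(SUP n. emeasure M (A n)) = emeasure M (\<Union>n. A n)"
  proof (rule SUP_emeasure_incseq)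
    show "range A \<subseteq> sets M" unfolding A_def by auto
    show "incseq A"
    proof (rule incseq_SucI, rule subsetI)
      fix n x assume "x \<in> A n"
      moreover have "ennreal (t + 1 / Suc (Suc n)) \<le> ennreal (t + 1 / Suc n)"
        by (intro ennreal_leI add_left_mono divide_left_mono) auto
      ultimately show "x \<in> A (Suc n)" unfolding A_def by (auto intro: le_less_trans)
    qed
  qed
  also have "(\<Union>n. A n) = {x\<in>space M. v x > ennreal t}"
  proof (intro equalityI subsetI)
    fix x assume "x \<in> (\<Union>n. A n)"
    then obtain n where "x \<in> space M" "v x > ennreal (t + 1 / Suc n)" unfolding A_def by auto
    moreover have "ennreal t \<le> ennreal (t + 1 / Suc n)" by (intro ennreal_leI) simp
    ultimately show "x \<in> {x\<in>space M. v x > ennreal t}" by auto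
  next
    fix x assume x: "x \<in> {x\<in>space M. v x > ennreal t}"
    obtain n where "ennreal (t + 1 / Suc n) < v x"
    proof (cases "v x")
      case (real r)
      then have "r - t > 0" using x t by (auto simp: ennreal_less_iff)
      then obtain n where "1 / Suc n < r - t" using nat_approx_posE by metis
      then have "ennreal (t + 1 / Suc n) < ennreal r" using \<open>r - t > 0\<close> t by (intro ennreal_lessI) auto
      then show thesis using that[of n] real by simp
    next
      case top
      then show thesis using that[of 0] by simp
    qed
    then show "x \<in> (\<Union>n. A n)" using x unfolding A_def by auto
  qed
  finally have "(SUP n. emeasure M (A n)) > ennreal s" using * by (simp add: distribution_fun_def)
  then obtain n where n: "emeasure M (A n) > ennreal s" unfolding less_SUP_iff by auto
  have "ennreal t < ennreal (t + 1 / Suc n)" using t by (simp add: ennreal_less_iff)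
  also have "\<dots> \<le> rearrangement M v s"
    unfolding rearrangement_def
    by (rule Sup_upper) (use t n in \<open>auto simp: distribution_fun_def A_def intro!: exI[of _ "t + 1 / Suc n"]\<close>)
  finally show "rearrangement M v s > ennreal t" .
qed

lemma ennreal_le_via_reals:
  fixes a b :: ennreal
  assumes "\<And>t. t \<ge> 0 \<Longrightarrow> a > ennreal t \<Longrightarrow> b \<ge> ennreal t"
  shows "a \<le> b"
proof (rule dense_le)
  fix y assume y: "y < a"
  then have "y \<noteq> top" by auto
  then obtain t where "t \<ge> 0" "y = ennreal t" by (cases y) auto
  then show "y \<le> b" using assms y by auto
qed

lemma rearrangement_measurable:
  assumes v: "v \<in> borel_measurable M"
  shows "rearrangement M v \<in> borel_measurable borel"
proof (rule borel_measurableI_greater)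
  fix y :: ennreal
  show "{x \<in> space borel. y < rearrangement M v x} \<in> sets borel"
  proof (cases y)
    case (real t)
    then have "{x \<in> space borel. y < rearrangement M v x} = {x. ennreal x < distribution_fun M v t}"
      by (simp add: rearrangement_gt_iff[OF v])
    also have "\<dots> \<in> sets borel" by measurable
    finally show ?thesis .
  qed simp
qed

section \<open>Boyd indices\<close>

text \<open>Fekete's lemma with a real parameter; the limit is the infimum of \<open>G t / t\<close>
  over \<open>t \<ge> 1\<close>. Take a nearly optimal \<open>t0\<close> and divide \<open>t\<close>
  by it: subadditivity handles the multiple of \<open>t0\<close>, and boundedness on one window
  handles the remainder.\<close>

lemma fekete_real:
  fixes G :: "real \<Rightarrow> real"
  assumes sub: "\<And>s t. s > 0 \<Longrightarrow> t > 0 \<Longrightarrow> G (s + t) \<le> G s + G t"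
    and lower: "\<And>t. t \<ge> 1 \<Longrightarrow> G t / t \<ge> K"
    and upper: "\<And>a. a \<ge> 1 \<Longrightarrow> \<exists>B. \<forall>t\<in>{a..2*a}. G t \<le> B"
  obtains l where "((\<lambda>t. G t / t) \<longlongrightarrow> l) at_top"
proof
  define A where "A = (\<lambda>t. G t / t) ` {1..}"
  have bdd: "bdd_below A" unfolding A_def using lower by (auto intro!: bdd_belowI[of _ K])
  show "((\<lambda>t. G t / t) \<longlongrightarrow> Inf A) at_top"
  proof (rule order_tendstoI)
    fix y assume "y < Inf A"
    have "\<forall>\<^sub>F t in at_top. t \<ge> (1::real)" by (rule eventually_ge_at_top)
    then show "\<forall>\<^sub>F t in at_top. y < G t / t"
    proof eventually_elim
      case (elim t)
      then have "Inf A \<le> G t / t" by (intro cInf_lower bdd) (auto simp: A_def)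
      with \<open>y < Inf A\<close> show ?case by simp
    qed
  next
    fix y assume "Inf A < y"
    moreover have "A \<noteq> {}" by (auto simp: A_def)
    ultimately obtain t0 where t0: "t0 \<ge> 1" "G t0 / t0 < y"
      using bdd by (auto simp: cInf_less_iff A_def)
    define q where "q = G t0 / t0"
    obtain B where B: "\<And>r. r \<in> {t0..2*t0} \<Longrightarrow> G r \<le> B" using upper[OF t0(1)] by blast
    have iter: "G (real n * t0 + r) \<le> real n * G t0 + G r" if "r > 0" for n r
    proof (induction n)
      case (Suc n)
      have "G (real (Suc n) * t0 + r) = G (t0 + (real n * t0 + r))" by (simp add: algebra_simps)
      also have "\<dots> \<le> G t0 + G (real n * t0 + r)"
        using t0(1) that by (intro sub) (auto intro: add_nonneg_pos)
      finally show ?case using Suc by (simp add: algebra_simps)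
    qed simp
    have key: "G t / t \<le> q + (2 * t0 * \<bar>q\<bar> + \<bar>B\<bar>) / t" if t: "t \<ge> t0" for t
    proof -
      define m where "m = \<lfloor>t / t0\<rfloor>"
      have m1: "of_int m * t0 \<le> t" unfolding m_def using t0(1)
        by (simp add: pos_le_divide_eq[symmetric])
      have "t / t0 < of_int m + 1" unfolding m_def by linarith
      then have m2: "t < (of_int m + 1) * t0" using t0(1) by (simp add: pos_divide_less_eq)
      have "m \<ge> 1" unfolding m_def using t t0(1) by simp
      then obtain n where n: "m = int n + 1"
        by (metis add.commute int_ops(2) nonneg_int_cases zle_iff_zadd)
      \<comment> \<open>One copy of \<open>t0\<close> fewer than possible is split off. The
        remainder then lies in \<open>{t0..2*t0}\<close>, away from 0, where both subadditivity and
        the upper bound apply.\<close>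
      define r where "r = t - real n * t0"
      have r: "r \<in> {t0..2*t0}" using m1 m2 unfolding r_def n by (simp add: algebra_simps)
      have nt: "real n * t0 = t - r" by (simp add: r_def)
      have "G t = G (real n * t0 + r)" by (simp add: r_def)
      also have "\<dots> \<le> real n * G t0 + G r" using r t0(1) by (intro iter) auto
      also have "real n * G t0 = (t - r) * q" unfolding nt[symmetric] q_def using t0(1) by simp
      also have "(t - r) * q \<le> t * q + 2 * t0 * \<bar>q\<bar>"
      proof -
        have "r * (- q) \<le> r * \<bar>q\<bar>" using r t0(1) by (intro mult_left_mono) auto
        also have "\<dots> \<le> 2 * t0 * \<bar>q\<bar>" using r by (intro mult_right_mono) auto
        finally show ?thesis by (simp add: algebra_simps)
      qed
      also have "G r \<le> \<bar>B\<bar>" using B[OF r] by simp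
      finally have "G t \<le> t * q + 2 * t0 * \<bar>q\<bar> + \<bar>B\<bar>" by simp
      then show ?thesis using t t0(1) by (simp add: field_simps)
    qed
    have "((\<lambda>t. q + (2 * t0 * \<bar>q\<bar> + \<bar>B\<bar>) / t) \<longlongrightarrow> q + 0) at_top"
      by (intro tendsto_add tendsto_const tendsto_divide_0[OF tendsto_const])
        (rule filterlim_at_top_imp_at_infinity, rule filterlim_ident)
    then have "\<forall>\<^sub>F t in at_top. q + (2 * t0 * \<bar>q\<bar> + \<bar>B\<bar>) / t < y"
      using t0(2) by (intro order_tendstoD) (auto simp: q_def)
    then show "\<forall>\<^sub>F t in at_top. G t / t < y"
      using eventually_ge_at_top[of t0]
    proof eventually_elim
      case (elim t)
      then show ?case using key[of t] by linarith
    qed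
  qed
qed

locale ri_curve = jordan_curve +
  fixes \<rho> :: "(complex \<Rightarrow> ennreal) \<Rightarrow> ennreal"
  assumes ri: "ri_bfs M \<rho>"
begin

sublocale bfn M \<rho>
  using ri by unfold_locales (simp add: ri_bfs_def)

section \<open>The dilation norm expressed through distribution functions\<close>

lemma rho_equimeasurable:
  assumes "u \<in> borel_measurable M" "v \<in> borel_measurable M"
    "\<And>t. t \<ge> 0 \<Longrightarrow> distribution_fun M u t = distribution_fun M v t"
  shows "\<rho> u = \<rho> v"
proof -
  have "rearrangement_invariant M \<rho>" using ri unfolding ri_bfs_def by blast
  moreover have "equimeasurable M u M v"
    unfolding equimeasurable_def using assms(3) unfolding distribution_fun_def by blast
  ultimately show ?thesis unfolding rearrangement_invariant_def using assms(1,2) by blast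
qed

text \<open>The function \<open>h_X\<close> before \<open>enn2real\<close>. Infinite values stay
  visible here, while in \<open>boyd_h\<close> they would become 0.\<close>

definition dilation_norm :: "real \<Rightarrow> ennreal" where
  "dilation_norm x = (SUP h\<in>{h\<in>borel_measurable (restrict_space lborel {0..L}). lux_rep \<gamma> L \<rho> h \<le> 1}.
      lux_rep \<gamma> L \<rho> (dilation L (1 / x) h))"

lemma boyd_h_eq: "boyd_h \<gamma> L \<rho> x = enn2real (dilation_norm x)"
  unfolding boyd_h_def dilation_norm_def ..

lemma distribution_fun_le: "distribution_fun M v t \<le> ennreal L"
  unfolding distribution_fun_def emeasure_curve[symmetric] space_M[symmetric]
  by (rule emeasure_space)

lemma borel_restrict: "h \<in> borel_measurable borel \<Longrightarrow> h \<in> borel_measurable (restrict_space lborel {0..L})"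
  by (rule measurable_restrict_space1) simp

lemma emeasure_initial_segment:
  "emeasure lborel {s\<in>{0..<L}. ennreal s < d} = min d (ennreal L)"
proof (cases d)
  case (real r)
  then have "{s\<in>{0..<L}. ennreal s < d} = {0..<min r L}" by (auto simp: ennreal_less_iff)
  then show ?thesis using real L_pos by (auto simp: min_def ennreal_leI)
next
  case top
  then have "{s\<in>{0..<L}. ennreal s < d} = {0..<L}" by auto
  then show ?thesis using top L_pos by simp
qed

text \<open>Realises \<open>y\<close> times the distribution function of \<open>v\<close>, cut at
  the total length, by an actual function on the curve. It is the intermediate function between two
  successive dilations.\<close>

lemma dilated_rearrangement:
  assumes v: "v \<in> borel_measurable M" and y: "y > 0"
  shows "(\<lambda>\<tau>. rearrangement M v (coord \<tau> / y)) \<in> borel_measurable M" (is "?w \<in> _")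
    and "t \<ge> 0 \<Longrightarrow> distribution_fun M (\<lambda>\<tau>. rearrangement M v (coord \<tau> / y)) t
          = min (ennreal y * distribution_fun M v t) (ennreal L)"
proof -
  have m [measurable]: "(\<lambda>s. rearrangement M v (s / y)) \<in> borel_measurable borel"
    using rearrangement_measurable[OF v] by measurable
  show "?w \<in> borel_measurable M" using compose_coord_measurable[OF borel_restrict[OF m]] .
  assume t: "t \<ge> 0"
  have "distribution_fun M ?w t = emeasure lborel {s\<in>{0..<L}. rearrangement M v (s / y) > ennreal t}"
    unfolding distribution_fun_def by (rule emeasure_compose_coord[OF borel_restrict[OF m]])
  also have "{s\<in>{0..<L}. rearrangement M v (s / y) > ennreal t}
      = {s\<in>{0..<L}. ennreal s < ennreal y * distribution_fun M v t}"
  proof -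
    have "ennreal (s / y) < d \<longleftrightarrow> ennreal s < ennreal y * d" if "s \<ge> 0" for s d
      using that y by (cases d) (auto simp: ennreal_less_iff ennreal_mult[symmetric] ennreal_mult_top field_simps)
    then show ?thesis by (auto simp: rearrangement_gt_iff[OF v t])
  qed
  also have "emeasure lborel \<dots> = min (ennreal y * distribution_fun M v t) (ennreal L)"
    by (rule emeasure_initial_segment)
  finally show "distribution_fun M ?w t = min (ennreal y * distribution_fun M v t) (ennreal L)" .
qed

lemma rho_rearrangement:
  assumes v: "v \<in> borel_measurable M"
  shows "(\<lambda>\<tau>. rearrangement M v (coord \<tau>)) \<in> borel_measurable M"
    and "\<rho> (\<lambda>\<tau>. rearrangement M v (coord \<tau>)) = \<rho> v"
proof -
  note * = dilated_rearrangement[OF v zero_less_one, simplified]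
  show m: "(\<lambda>\<tau>. rearrangement M v (coord \<tau>)) \<in> borel_measurable M" by (rule *(1))
  show "\<rho> (\<lambda>\<tau>. rearrangement M v (coord \<tau>)) = \<rho> v"
    by (rule rho_equimeasurable[OF m v]) (simp add: *(2) distribution_fun_le min_absorb1)
qed

lemma dilation_measurable:
  assumes h: "h \<in> borel_measurable (restrict_space lborel {0..L})"
  shows "dilation L a h \<in> borel_measurable borel"
proof -
  have [measurable]: "(\<lambda>s. if s \<in> {0..L} then h s else 0) \<in> borel_measurable borel"
    using h by (subst (asm) measurable_restrict_space_iff[of _ _ 0]) auto
  have "dilation L a h = (\<lambda>s. (\<lambda>s. if s \<in> {0..L} then h s else 0) (a * s))"
    by (auto simp: dilation_def fun_eq_iff)
  also have "\<dots> \<in> borel_measurable borel" by measurable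
  finally show ?thesis .
qed

text \<open>The assumption on distribution functions says that the rearrangement of \<open>u\<close>
  is dominated by the dilation by \<open>1 / x\<close> of that of \<open>v\<close>; rearrangement
  invariance then replaces both functions by their rearrangements. All later estimates of
  composition operators pass through this.\<close>

lemma rho_le_dilation_norm:
  assumes u: "u \<in> borel_measurable M" and v: "v \<in> borel_measurable M" and x: "x > 0"
    and fin: "\<rho> v < \<infinity>"
    and d: "\<And>t. t \<ge> 0 \<Longrightarrow> distribution_fun M u t \<le> ennreal x * distribution_fun M v t"
  shows "\<rho> u \<le> dilation_norm x * \<rho> v"
\<comment> \<open>Normalising by the norm of \<open>v\<close> is impossible here, and
  \<open>dilation_norm x\<close> could be infinite with product 0. So \<open>u\<close> itself has to
  be shown null.\<close>
proof (cases "\<rho> v = 0")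
  case True
  then have "AE \<tau> in M. v \<tau> = 0" using rho_zero_iff[OF v] by simp
  then have "distribution_fun M v 0 = 0"
    unfolding distribution_fun_def using v by (intro emeasure_eq_0_AE) (auto elim: eventually_mono)
  then have "distribution_fun M u 0 = 0" using d[of 0] by simp
  moreover have "{\<tau>\<in>space M. u \<tau> > ennreal 0} \<in> sets M"
    using u by (rule borel_measurable_less[OF borel_measurable_const])
  ultimately have "{\<tau>\<in>space M. u \<tau> > ennreal 0} \<in> null_sets M"
    unfolding distribution_fun_def by (rule null_setsI)
  then have "AE \<tau> in M. u \<tau> = 0"
    by (rule AE_I') (auto simp: zero_less_iff_neq_zero)
  then have "\<rho> u = 0" using rho_zero_iff[OF u] by simp
  then show ?thesis by simp
next
  case False
  obtain r where r: "\<rho> v = ennreal r" "r > 0"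
    using False fin by (cases "\<rho> v") auto
  define vs where "vs = rearrangement M v"
  have vs: "vs \<in> borel_measurable borel" unfolding vs_def by (rule rearrangement_measurable[OF v])
  have lux_vs: "lux_rep \<gamma> L \<rho> vs = ennreal r"
    unfolding lux_rep_def vs_def using rho_rearrangement(2)[OF v] r by simp
  define h where "h s = ennreal (1 / r) * vs s" for s
  have h: "h \<in> borel_measurable (restrict_space lborel {0..L})"
    using vs unfolding h_def by (intro borel_restrict) measurable
  have "lux_rep \<gamma> L \<rho> h = ennreal (1 / r) * lux_rep \<gamma> L \<rho> vs"
    unfolding lux_rep_def h_def
    by (rule rho_scale) (use compose_coord_measurable[OF borel_restrict[OF vs]] r in auto)
  then have "lux_rep \<gamma> L \<rho> h \<le> 1" using r lux_vs by (simp add: ennreal_mult[symmetric])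
  with h have le: "lux_rep \<gamma> L \<rho> (dilation L (1 / x) h) \<le> dilation_norm x"
    unfolding dilation_norm_def by (intro SUP_upper) auto
  note dv = dilation_measurable[OF borel_restrict[OF vs], of "1 / x"]
  note dv' = compose_coord_measurable[OF borel_restrict[OF dv]]
  have dom: "rearrangement M u s \<le> dilation L (1 / x) vs s" if s: "s \<ge> 0" for s
  proof (rule ennreal_le_via_reals)
    fix t :: real assume t: "t \<ge> 0" and "rearrangement M u s > ennreal t"
    then have "ennreal s < distribution_fun M u t" by (simp add: rearrangement_gt_iff[OF u])
    also have "\<dots> \<le> ennreal x * distribution_fun M v t" by (rule d[OF t])
    finally have lt: "ennreal (s / x) < distribution_fun M v t"
      using s x by (cases "distribution_fun M v t")
        (auto simp: ennreal_less_iff ennreal_mult[symmetric] field_simps)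
    \<comment> \<open>The cut-off in \<open>dilation\<close> is harmless: a distribution function
      never exceeds \<open>L\<close>, so the argument \<open>s / x\<close> stays inside
      \<open>{0..L}\<close>.\<close>
    then have "ennreal (s / x) < ennreal L" using distribution_fun_le[of v t] by (rule less_le_trans)
    then have "1 / x * s \<in> {0..L}" using s x by (auto simp: ennreal_less_iff)
    moreover have "vs (s / x) > ennreal t" using lt unfolding vs_def by (simp add: rearrangement_gt_iff[OF v t])
    ultimately show "dilation L (1 / x) vs s \<ge> ennreal t" by (simp add: dilation_def)
  qed
  have "\<rho> u = \<rho> (\<lambda>\<tau>. rearrangement M u (coord \<tau>))" by (rule rho_rearrangement(2)[OF u, symmetric])
  also have "\<dots> \<le> lux_rep \<gamma> L \<rho> (dilation L (1 / x) vs)"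
    unfolding lux_rep_def
    by (rule rho_mono[OF dv' rho_rearrangement(1)[OF u]]) (use coord_in in \<open>auto intro!: AE_I2 dom\<close>)
  also have "dilation L (1 / x) vs = (\<lambda>s. ennreal r * dilation L (1 / x) h s)"
    unfolding dilation_def h_def using r
    by (auto simp: fun_eq_iff mult.assoc[symmetric] ennreal_mult[symmetric])
  also have "lux_rep \<gamma> L \<rho> \<dots> = ennreal r * lux_rep \<gamma> L \<rho> (dilation L (1 / x) h)"
    unfolding lux_rep_def
    by (rule rho_scale) (use compose_coord_measurable[OF borel_restrict[OF dilation_measurable[OF h]]] r in auto)
  also have "\<dots> \<le> ennreal r * dilation_norm x" by (rule mult_left_mono[OF le]) simp
  finally show ?thesis by (simp add: r mult.commute)
qed

text \<open>Converse of \<open>rho_le_dilation_norm\<close>: a dilation by \<open>1 / x\<close>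
  multiplies distribution functions by at most \<open>x\<close>. Hence
  \<open>dilation_norm x\<close> is the best constant in that comparison, and its properties can be
  proved without rearrangements.\<close>

lemma dilation_norm_leI:
  assumes x: "x > 0"
    and *: "\<And>u v. u \<in> borel_measurable M \<Longrightarrow> v \<in> borel_measurable M \<Longrightarrow> \<rho> v \<le> 1 \<Longrightarrow>
      (\<And>t. t \<ge> 0 \<Longrightarrow> distribution_fun M u t \<le> ennreal x * distribution_fun M v t) \<Longrightarrow> \<rho> u \<le> c"
  shows "dilation_norm x \<le> c"
  unfolding dilation_norm_def
proof (rule SUP_least)
  fix h assume "h \<in> {h\<in>borel_measurable (restrict_space lborel {0..L}). lux_rep \<gamma> L \<rho> h \<le> 1}"
  then have h: "h \<in> borel_measurable (restrict_space lborel {0..L})" and h1: "lux_rep \<gamma> L \<rho> h \<le> 1" by auto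
  have h'[measurable]: "(\<lambda>s. if s \<in> {0..L} then h s else 0) \<in> borel_measurable borel"
    using h by (subst (asm) measurable_restrict_space_iff[of _ _ 0]) auto
  note dh = borel_restrict[OF dilation_measurable[OF h, of "1 / x"]]
  show "lux_rep \<gamma> L \<rho> (dilation L (1 / x) h) \<le> c"
    unfolding lux_rep_def
  proof (rule *)
    show "(\<lambda>\<tau>. dilation L (1 / x) h (coord \<tau>)) \<in> borel_measurable M" by (rule compose_coord_measurable[OF dh])
    show "(\<lambda>\<tau>. h (coord \<tau>)) \<in> borel_measurable M" by (rule compose_coord_measurable[OF h])
    show "\<rho> (\<lambda>\<tau>. h (coord \<tau>)) \<le> 1" using h1 unfolding lux_rep_def .
    fix t :: real assume "t \<ge> 0"
    define B where "B = {r. (if r \<in> {0..L} then h r else 0) > ennreal t}"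
    have B [measurable]: "B \<in> sets borel" unfolding B_def by measurable
    have B': "B = {r\<in>{0..L}. h r > ennreal t}" unfolding B_def by auto
    have "distribution_fun M (\<lambda>\<tau>. dilation L (1 / x) h (coord \<tau>)) t
        = emeasure lborel {s\<in>{0..<L}. dilation L (1 / x) h s > ennreal t}"
      unfolding distribution_fun_def by (rule emeasure_compose_coord[OF dh])
    also have "\<dots> \<le> emeasure lborel {s. s / x \<in> B}"
    proof (rule emeasure_mono)
      show "{s\<in>{0..<L}. dilation L (1 / x) h s > ennreal t} \<subseteq> {s. s / x \<in> B}"
        unfolding dilation_def B' by (auto split: if_splits)
      show "{s. s / x \<in> B} \<in> sets lborel" by measurable
    qed
    also have "\<dots> = (\<integral>\<^sup>+s. indicator {s. s / x \<in> B} s \<partial>lborel)" by simp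
    also have "\<dots> = ennreal x * (\<integral>\<^sup>+r. indicator {s. s / x \<in> B} (0 + x * r) \<partial>lborel)"
      using x by (subst nn_integral_real_affine[where c=x and t=0]) auto
    also have "(\<integral>\<^sup>+r. indicator {s. s / x \<in> B} (0 + x * r) \<partial>lborel) = (\<integral>\<^sup>+r. indicator B r \<partial>lborel)"
      using x by (intro nn_integral_cong) (auto simp: indicator_def)
    also have "\<dots> = emeasure lborel B" by simp
    \<comment> \<open>Dilations live on the closed interval and the coordinate takes values in the
      half-open one; they differ by the null set \<open>{L}\<close>.\<close>
    also have "\<dots> = emeasure lborel {r\<in>{0..<L}. h r > ennreal t}"
    proof (rule antisym)
      have 1: "{r\<in>{0..<L}. h r > ennreal t} = B - {L}" unfolding B' by auto
      show "emeasure lborel B \<le> emeasure lborel {r\<in>{0..<L}. h r > ennreal t}"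
        unfolding 1 by (subst emeasure_Diff_null_set) auto
      show "emeasure lborel {r\<in>{0..<L}. h r > ennreal t} \<le> emeasure lborel B"
        unfolding 1 by (intro emeasure_mono) auto
    qed
    also have "\<dots> = distribution_fun M (\<lambda>\<tau>. h (coord \<tau>)) t"
      unfolding distribution_fun_def by (rule emeasure_compose_coord[OF h, symmetric])
    finally show "distribution_fun M (\<lambda>\<tau>. dilation L (1 / x) h (coord \<tau>)) t
        \<le> ennreal x * distribution_fun M (\<lambda>\<tau>. h (coord \<tau>)) t"
      by (simp add: mult_left_mono)
  qed
qed

text \<open>A larger factor only weakens the constraint between the distribution functions. For an
  arbitrary \<open>h\<close> the dilated functions themselves need not be ordered.\<close>

lemma dilation_norm_mono:
  assumes "0 < x" "x \<le> y"
  shows "dilation_norm x \<le> dilation_norm y"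
proof (rule dilation_norm_leI[OF assms(1)])
  fix u v assume uv: "u \<in> borel_measurable M" "v \<in> borel_measurable M" "\<rho> v \<le> 1"
    and d: "\<And>t. t \<ge> 0 \<Longrightarrow> distribution_fun M u t \<le> ennreal x * distribution_fun M v t"
  have "\<rho> u \<le> dilation_norm y * \<rho> v"
  proof (rule rho_le_dilation_norm[OF uv(1,2)])
    show "\<rho> v < \<infinity>" using uv(3) by (auto intro: le_less_trans)
    fix t :: real assume "t \<ge> 0"
    from d[OF this] show "distribution_fun M u t \<le> ennreal y * distribution_fun M v t"
      by (rule order_trans) (intro mult_right_mono ennreal_leI assms, simp)
  qed (use assms in auto)
  also have "\<dots> \<le> dilation_norm y * 1" by (intro mult_left_mono uv) simp
  finally show "\<rho> u \<le> dilation_norm y" by simp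
qed

text \<open>Insert \<open>w\<close> between \<open>u\<close> and \<open>v\<close>, with distribution
  function \<open>y\<close> times that of \<open>v\<close> cut at \<open>L\<close>. With
  \<open>y > 1\<close> and \<open>x < 1\<close> the cut could lose what \<open>x\<close> still
  needs, hence \<open>xy\<close>. Finiteness at \<open>y\<close> is what allows \<open>w\<close> to
  be compared with \<open>u\<close>.\<close>

lemma dilation_norm_submult_aux:
  assumes x: "0 < x" and y: "0 < y" and xy: "y \<le> 1 \<or> x \<ge> 1" and fin: "dilation_norm y < \<infinity>"
  shows "dilation_norm (x * y) \<le> dilation_norm x * dilation_norm y"
proof (rule dilation_norm_leI)
  fix u v assume u: "u \<in> borel_measurable M" and v: "v \<in> borel_measurable M" and v1: "\<rho> v \<le> 1"
    and d: "\<And>t. t \<ge> 0 \<Longrightarrow> distribution_fun M u t \<le> ennreal (x * y) * distribution_fun M v t"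
  define w where "w \<tau> = rearrangement M v (coord \<tau> / y)" for \<tau>
  note w = dilated_rearrangement[OF v y, folded w_def]
  have vfin: "\<rho> v < \<infinity>" using v1 by (auto intro: le_less_trans)
  have "\<rho> w \<le> dilation_norm y * \<rho> v"
    by (rule rho_le_dilation_norm[OF w(1) v y vfin]) (simp add: w(2))
  also have "\<dots> \<le> dilation_norm y * 1" by (intro mult_left_mono v1) simp
  finally have wy: "\<rho> w \<le> dilation_norm y" by simp
  have "\<rho> u \<le> dilation_norm x * \<rho> w"
  proof (rule rho_le_dilation_norm[OF u w(1) x])
    show "\<rho> w < \<infinity>" using wy fin by (rule le_less_trans)
    fix t :: real assume t: "t \<ge> 0"
    have "distribution_fun M u t \<le> ennreal x * (ennreal y * distribution_fun M v t)"
      using d[OF t] x y by (simp add: ennreal_mult mult.assoc)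
    \<comment> \<open>Only a cut distribution function needs an argument. For
      \<open>x \<ge> 1\<close> the product \<open>x * L\<close> is at least any distribution
      function; for \<open>y \<le> 1\<close> a cut can happen only with equality.\<close>
    moreover have "distribution_fun M u t \<le> ennreal x * min (ennreal y * distribution_fun M v t) (ennreal L)"
      if "ennreal L \<le> ennreal y * distribution_fun M v t"
    proof (cases "x \<ge> 1")
      case True
      have "distribution_fun M u t \<le> ennreal 1 * ennreal L" using distribution_fun_le by simp
      also have "\<dots> \<le> ennreal x * ennreal L" using True by (intro mult_right_mono ennreal_leI) auto
      finally show ?thesis using that by (simp add: min_absorb2)
    next
      case False
      then have "y \<le> 1" using xy by simp
      have "ennreal y * distribution_fun M v t \<le> ennreal 1 * ennreal L"
        by (intro mult_mono ennreal_leI \<open>y \<le> 1\<close> distribution_fun_le) auto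
      with that have "ennreal y * distribution_fun M v t = ennreal L" by simp
      with \<open>distribution_fun M u t \<le> ennreal x * (ennreal y * distribution_fun M v t)\<close>
      show ?thesis by simp
    qed
    ultimately show "distribution_fun M u t \<le> ennreal x * distribution_fun M w t"
      unfolding w(2)[OF t] by (cases "ennreal L \<le> ennreal y * distribution_fun M v t") (auto simp: min_def)
  qed
  also have "\<dots> \<le> dilation_norm x * dilation_norm y" by (intro mult_left_mono wy) simp
  finally show "\<rho> u \<le> dilation_norm x * dilation_norm y" .
qed (use x y in simp)

lemma dilation_norm_one: "dilation_norm 1 \<ge> 1"
proof -
  have "\<rho> (\<lambda>_. 1) \<le> dilation_norm 1 * \<rho> (\<lambda>_. 1)"
    by (rule rho_le_dilation_norm) (use rho_one_finite in auto)
  moreover have "\<rho> (\<lambda>_. 1) \<noteq> 0"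
  proof
    assume "\<rho> (\<lambda>_. 1) = 0"
    then have "AE x in M. (1::ennreal) = 0" using rho_zero_iff[of "\<lambda>_. 1"] by simp
    then have "emeasure M (space M) = 0"
      using AE_iff_measurable[OF sets.top, of M "\<lambda>_. False"] by simp
    then show False using L_pos by (simp add: emeasure_curve)
  qed
  then obtain r where r: "\<rho> (\<lambda>_. 1) = ennreal r" "r > 0"
    using rho_one_finite by (cases "\<rho> (\<lambda>_. 1)") auto
  ultimately show ?thesis
    by (cases "dilation_norm 1") (auto simp: ennreal_mult[symmetric] top_unique)
qed

text \<open>By monotonicity one infinite value forces infinite values from there on. Then
  \<open>enn2real\<close> gives 0 and \<open>ln 0 = 0\<close>, so the upper index would be 0,
  against its positivity.\<close>

lemma dilation_norm_finite:
  assumes "boyd_upper \<gamma> L \<rho> > 0" and x: "x > 0"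
  shows "dilation_norm x < \<infinity>"
proof (rule ccontr)
  assume "\<not> dilation_norm x < \<infinity>"
  then have "dilation_norm x = \<infinity>" by (simp add: less_top[symmetric])
  then have "dilation_norm y = \<infinity>" if "y \<ge> x" for y
    using dilation_norm_mono[OF x that] by (simp add: top_unique)
  then have "\<forall>\<^sub>F y in at_top. ln (boyd_h \<gamma> L \<rho> y) / ln y = 0"
    by (intro eventually_at_top_linorderI[of x]) (simp add: boyd_h_eq)
  then have "((\<lambda>y. ln (boyd_h \<gamma> L \<rho> y) / ln y) \<longlongrightarrow> 0) at_top" by (rule tendsto_eventually)
  then have "boyd_upper \<gamma> L \<rho> = 0" unfolding boyd_upper_def by (intro tendsto_Lim) simp_all
  then show False using assms(1) by simp
qed

section \<open>Existence of the Boyd limits and the resulting growth bound\<close>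

context
  assumes upper_pos: "boyd_upper \<gamma> L \<rho> > 0"
begin

lemma ennreal_boyd_h: "x > 0 \<Longrightarrow> ennreal (boyd_h \<gamma> L \<rho> x) = dilation_norm x"
  unfolding boyd_h_eq using dilation_norm_finite[OF upper_pos] by simp

lemma boyd_h_nonneg: "boyd_h \<gamma> L \<rho> x \<ge> 0"
  by (simp add: boyd_h_eq)

lemma boyd_h_mono: "0 < x \<Longrightarrow> x \<le> y \<Longrightarrow> boyd_h \<gamma> L \<rho> x \<le> boyd_h \<gamma> L \<rho> y"
  using dilation_norm_mono[of x y] ennreal_boyd_h[of x] ennreal_boyd_h[of y]
  by (metis boyd_h_nonneg ennreal_le_iff less_le_trans)

lemma boyd_h_submult:
  assumes "0 < x" "0 < y"
  shows "boyd_h \<gamma> L \<rho> (x * y) \<le> boyd_h \<gamma> L \<rho> x * boyd_h \<gamma> L \<rho> y"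
proof -
  have "dilation_norm (x * y) \<le> dilation_norm x * dilation_norm y"
  proof (cases "y \<le> 1 \<or> x \<ge> 1")
    case True
    then show ?thesis by (intro dilation_norm_submult_aux assms dilation_norm_finite[OF upper_pos])
  next
    case False
    then have "dilation_norm (y * x) \<le> dilation_norm y * dilation_norm x"
      by (intro dilation_norm_submult_aux assms dilation_norm_finite[OF upper_pos]) auto
    then show ?thesis by (simp only: mult.commute)
  qed
  then have "ennreal (boyd_h \<gamma> L \<rho> (x * y)) \<le> ennreal (boyd_h \<gamma> L \<rho> x * boyd_h \<gamma> L \<rho> y)"
    using assms by (simp add: ennreal_boyd_h ennreal_mult boyd_h_nonneg)
  then show ?thesis by (simp add: ennreal_le_iff boyd_h_nonneg)
qed

lemma boyd_h_one: "boyd_h \<gamma> L \<rho> 1 \<ge> 1"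
proof -
  have "ennreal 1 \<le> ennreal (boyd_h \<gamma> L \<rho> 1)"
    using dilation_norm_one by (simp add: ennreal_boyd_h)
  then show ?thesis by (subst (asm) ennreal_le_iff) (auto simp: boyd_h_nonneg)
qed

text \<open>From \<open>h 1 \<le> h x * h (1 / x)\<close>. Positivity lets logarithms turn
  submultiplicativity into subadditivity.\<close>

lemma boyd_h_pos: "x > 0 \<Longrightarrow> boyd_h \<gamma> L \<rho> x > 0"
proof -
  assume "x > 0"
  then have "1 \<le> boyd_h \<gamma> L \<rho> x * boyd_h \<gamma> L \<rho> (1 / x)"
    using boyd_h_submult[of x "1 / x"] boyd_h_one by simp
  then have "boyd_h \<gamma> L \<rho> x \<noteq> 0" by auto
  then show ?thesis using boyd_h_nonneg[of x] by linarith
qed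

lemma ln_boyd_h_add:
  "ln (boyd_h \<gamma> L \<rho> (exp (s + t))) \<le> ln (boyd_h \<gamma> L \<rho> (exp s)) + ln (boyd_h \<gamma> L \<rho> (exp t))"
proof -
  have "ln (boyd_h \<gamma> L \<rho> (exp s * exp t)) \<le> ln (boyd_h \<gamma> L \<rho> (exp s) * boyd_h \<gamma> L \<rho> (exp t))"
    by (subst ln_le_cancel_iff) (auto intro!: boyd_h_submult boyd_h_pos mult_pos_pos)
  then show ?thesis by (simp add: exp_add ln_mult_pos boyd_h_pos)
qed

lemma ln_boyd_h_mono: "s \<le> t \<Longrightarrow> ln (boyd_h \<gamma> L \<rho> (exp s)) \<le> ln (boyd_h \<gamma> L \<rho> (exp t))"
  by (subst ln_le_cancel_iff) (auto intro!: boyd_h_mono boyd_h_pos)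

lemma ln_boyd_h_zero: "ln (boyd_h \<gamma> L \<rho> (exp 0)) \<ge> 0"
  using boyd_h_one by simp

text \<open>\<open>Lim\<close> carries information only once a limit exists. Fekete's lemma provides
  it for \<open>ln (h (exp t))\<close>; monotonicity supplies both the lower bound and the bound on
  windows.\<close>

lemma boyd_upper_tendsto: "((\<lambda>x. ln (boyd_h \<gamma> L \<rho> x) / ln x) \<longlongrightarrow> boyd_upper \<gamma> L \<rho>) at_top"
proof -
  define G where "G t = ln (boyd_h \<gamma> L \<rho> (exp t))" for t
  obtain l where l: "((\<lambda>t. G t / t) \<longlongrightarrow> l) at_top"
  proof (rule fekete_real)
    show "G (s + t) \<le> G s + G t" for s t unfolding G_def by (rule ln_boyd_h_add)
    show "0 \<le> G t / t" if "t \<ge> 1" for t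
    proof (rule divide_nonneg_nonneg)
      show "0 \<le> G t" using that unfolding G_def by (intro order_trans[OF ln_boyd_h_zero ln_boyd_h_mono]) simp
    qed (use that in simp)
    show "\<exists>B. \<forall>t\<in>{a..2*a}. G t \<le> B" for a
      unfolding G_def
      by (rule exI[of _ "ln (boyd_h \<gamma> L \<rho> (exp (2 * a)))"]) (intro ballI ln_boyd_h_mono, simp)
  qed
  have "((\<lambda>x. G (ln x) / ln x) \<longlongrightarrow> l) at_top"
    by (rule filterlim_compose[OF l ln_at_top])
  moreover have "\<forall>\<^sub>F x in at_top. G (ln x) / ln x = ln (boyd_h \<gamma> L \<rho> x) / ln x"
    using eventually_gt_at_top[of 0] by eventually_elim (simp add: G_def)
  ultimately have lim: "((\<lambda>x. ln (boyd_h \<gamma> L \<rho> x) / ln x) \<longlongrightarrow> l) at_top"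
    by (rule Lim_transform_eventually)
  then have "boyd_upper \<gamma> L \<rho> = l" unfolding boyd_upper_def by (intro tendsto_Lim) simp_all
  with lim show ?thesis by simp
qed

text \<open>Fekete's lemma after reflecting \<open>t\<close> to \<open>- t\<close>. The lower bound
  is now the nontrivial assumption: \<open>F t + F (- t) \<ge> F 0 \<ge> 0\<close>, combined with at
  most linear growth of \<open>F\<close>.\<close>

lemma boyd_lower_tendsto: "((\<lambda>x. ln (boyd_h \<gamma> L \<rho> x) / ln x) \<longlongrightarrow> boyd_lower \<gamma> L \<rho>) (at_right 0)"
proof -
  define F where "F t = ln (boyd_h \<gamma> L \<rho> (exp t))" for t
  define G where "G t = F (- t)" for t
  have F0: "F 0 \<ge> 0" unfolding F_def by (rule ln_boyd_h_zero)
  have Fadd: "F (s + t) \<le> F s + F t" for s t unfolding F_def by (rule ln_boyd_h_add)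
  have Fmono: "F s \<le> F t" if "s \<le> t" for s t unfolding F_def by (rule ln_boyd_h_mono[OF that])
  have F_nat: "F (real n) \<le> real n * F 1 + F 0" for n
  proof (induction n)
    case (Suc n)
    then show ?case using Fadd[of "real n" 1] by (simp add: algebra_simps)
  qed simp
  have F1: "F 1 \<ge> 0" using F0 Fmono[of 0 1] by simp
  \<comment> \<open>Subadditivity bounds \<open>F\<close> at integers; for \<open>t \<ge> 1\<close>
    the next integer is at most \<open>2 * t\<close> and the constant \<open>F 0\<close> at most
    \<open>t * F 0\<close>.\<close>
  have F_lin: "F t \<le> t * (2 * F 1 + F 0)" if t: "t \<ge> 1" for t
  proof -
    have "F t \<le> F (real (nat \<lceil>t\<rceil>))" by (rule Fmono) (use t in linarith)
    also have "\<dots> \<le> real (nat \<lceil>t\<rceil>) * F 1 + F 0" by (rule F_nat)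
    also have "\<dots> \<le> (2 * t) * F 1 + t * F 0"
      using F1 F0 t mult_right_mono[of 1 t "F 0"] by (intro add_mono mult_right_mono) (linarith | simp)+
    finally show ?thesis by (simp add: algebra_simps)
  qed
  obtain l where l: "((\<lambda>t. G t / t) \<longlongrightarrow> l) at_top"
  proof (rule fekete_real)
    show "G (s + t) \<le> G s + G t" for s t unfolding G_def using Fadd[of "-s" "-t"] by simp
    show "- (2 * F 1 + F 0) \<le> G t / t" if t: "t \<ge> 1" for t
    proof -
      have "0 \<le> F t + G t" unfolding G_def using Fadd[of t "-t"] F0 by simp
      then have "- (2 * F 1 + F 0) * t \<le> G t" using F_lin[OF t] by (simp add: algebra_simps)
      then show ?thesis using t by (simp add: pos_le_divide_eq)
    qed
    show "\<exists>B. \<forall>t\<in>{a..2*a}. G t \<le> B" for a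
      unfolding G_def using Fmono by (intro exI[of _ "F (- a)"]) auto
  qed
  have neg_ln: "filterlim (\<lambda>x::real. - ln x) at_top (at_right 0)"
    using filterlim_compose[OF filterlim_uminus_at_top_at_bot ln_at_0] .
  have "((\<lambda>x. - (G (- ln x) / (- ln x))) \<longlongrightarrow> - l) (at_right 0)"
    by (intro tendsto_minus filterlim_compose[OF l neg_ln])
  moreover have "\<forall>\<^sub>F x in at_right 0. - (G (- ln x) / (- ln x)) = ln (boyd_h \<gamma> L \<rho> x) / ln x"
    unfolding eventually_at_right_field by (intro exI[of _ 1]) (simp add: G_def F_def)
  ultimately have lim: "((\<lambda>x. ln (boyd_h \<gamma> L \<rho> x) / ln x) \<longlongrightarrow> - l) (at_right 0)"
    by (rule Lim_transform_eventually)
  then have "boyd_lower \<gamma> L \<rho> = - l"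
    unfolding boyd_lower_def by (intro tendsto_Lim) (simp_all add: trivial_limit_at_right_real)
  with lim show ?thesis by simp
qed

text \<open>Exponents strictly beyond the indices give pure power bounds near 0 and near infinity.
  On the compact range between, \<open>h\<close> is bounded by monotonicity and
  \<open>x powr a\<close> is bounded below.\<close>

lemma dilation_norm_growth:
  assumes a: "a < boyd_lower \<gamma> L \<rho>" and b: "boyd_upper \<gamma> L \<rho> < b"
  obtains C where "C > 0" "\<And>x. x > 0 \<Longrightarrow> dilation_norm x \<le> ennreal (C * max (x powr a) (x powr b))"
proof -
  let ?h = "boyd_h \<gamma> L \<rho>"
  have "\<forall>\<^sub>F x in at_top. ln (?h x) / ln x < b"
    by (rule order_tendstoD(2)[OF boyd_upper_tendsto b])
  then obtain X0 where X0: "\<And>x. x \<ge> X0 \<Longrightarrow> ln (?h x) / ln x < b"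
    unfolding eventually_at_top_linorder by auto
  define X where "X = max X0 2"
  have hi: "?h x \<le> x powr b" if "x \<ge> X" for x
  proof -
    have x: "x > 1" "ln (?h x) / ln x < b" using that X0[of x] by (auto simp: X_def)
    then have "ln (?h x) < b * ln x" by (simp add: pos_divide_less_eq)
    then have "exp (ln (?h x)) \<le> exp (b * ln x)" by simp
    then show ?thesis using x(1) boyd_h_pos[of x] by (simp add: powr_def)
  qed
  have "\<forall>\<^sub>F x in at_right 0. a < ln (?h x) / ln x"
    by (rule order_tendstoD(1)[OF boyd_lower_tendsto a])
  then obtain e0 where e0: "e0 > 0" "\<And>x. 0 < x \<Longrightarrow> x < e0 \<Longrightarrow> a < ln (?h x) / ln x"
    unfolding eventually_at_right_field by auto
  define e where "e = min e0 1"
  have e: "0 < e" "e \<le> 1" using e0(1) by (auto simp: e_def)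
  have lo: "?h x \<le> x powr a" if "0 < x" "x < e" for x
  proof -
    have x: "x < 1" "a < ln (?h x) / ln x" using that e0(2)[of x] by (auto simp: e_def)
    then have "ln (?h x) < a * ln x" using that(1) by (simp add: neg_less_divide_eq)
    then have "exp (ln (?h x)) \<le> exp (a * ln x)" by simp
    then show ?thesis using that boyd_h_pos[of x] by (simp add: powr_def)
  qed
  \<comment> \<open>The minimum of \<open>x powr a\<close> over \<open>{e..X}\<close> sits at the
    left or the right end according to the sign of \<open>a\<close>, which is not fixed.\<close>
  define m where "m = min (e powr a) (X powr a)"
  have m: "m > 0" using e by (auto simp: m_def X_def)
  have mid: "?h x \<le> ?h X / m * x powr a" if x: "e \<le> x" "x \<le> X" for x
  proof -
    have "m \<le> x powr a"
    proof (cases "a \<ge> 0")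
      case True
      then have "e powr a \<le> x powr a" using e x by (intro powr_mono2) auto
      then show ?thesis by (simp add: m_def)
    next
      case False
      then have "X powr a \<le> x powr a" using e x by (intro powr_mono2') auto
      then show ?thesis by (simp add: m_def)
    qed
    then have "?h X * m \<le> ?h X * x powr a" by (intro mult_left_mono boyd_h_nonneg)
    moreover have "?h x \<le> ?h X" using e x by (intro boyd_h_mono) auto
    ultimately have "?h x \<le> ?h X * x powr a / m" using m by (simp add: pos_le_divide_eq mult_right_mono order_trans)
    then show ?thesis by simp
  qed
  define C where "C = max 1 (?h X / m)"
  show thesis
  proof (rule that[of C])
    show "C > 0" by (simp add: C_def)
    fix x :: real assume x: "x > 0"
    have "?h x \<le> C * max (x powr a) (x powr b)"
    proof -
      consider "x < e" | "e \<le> x" "x \<le> X" | "x \<ge> X" by linarith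
      then obtain p where p: "p = x powr a \<or> p = x powr b" "?h x \<le> C * p"
      proof cases
        case 1
        have "x powr a \<le> C * x powr a" using mult_right_mono[of 1 C "x powr a"] by (simp add: C_def)
        then show ?thesis using lo[OF x 1] by (intro that[of "x powr a"]) auto
      next
        case 2
        have "?h X / m * x powr a \<le> C * x powr a" by (intro mult_right_mono) (auto simp: C_def)
        then show ?thesis using mid[OF 2] by (intro that[of "x powr a"]) auto
      next
        case 3
        have "x powr b \<le> C * x powr b" using mult_right_mono[of 1 C "x powr b"] by (simp add: C_def)
        then show ?thesis using hi[OF 3] by (intro that[of "x powr b"]) auto
      qed
      have "C * p \<le> C * max (x powr a) (x powr b)"
        using p(1) by (intro mult_left_mono) (auto simp: C_def)
      with p(2) show ?thesis by simp
    qed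
    then show "dilation_norm x \<le> ennreal (C * max (x powr a) (x powr b))"
      unfolding ennreal_boyd_h[OF x, symmetric] by (rule ennreal_leI)
  qed
qed

end

end

section \<open>Orientation preserving diffeomorphisms with a fixed point\<close>

text \<open>Secant lengths determine the modulus of a derivative. Applied to a curve and to its
  reparametrisation, this isolates the derivative of the parameter change.\<close>

lemma has_vector_derivative_norm_quotient:
  fixes f :: "real \<Rightarrow> 'a::real_normed_vector"
  assumes "(f has_vector_derivative D) (at x)"
  shows "((\<lambda>y. norm (f y - f x) / \<bar>y - x\<bar>) \<longlongrightarrow> norm D) (at x)"
proof -
  have "((\<lambda>y. norm ((f y - f x) - (y - x) *\<^sub>R D) / norm (y - x)) \<longlongrightarrow> 0) (at x)"
    using assms unfolding has_vector_derivative_def has_derivative_iff_norm by blast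
  moreover have "\<forall>\<^sub>F y in at x. norm (norm (f y - f x) / \<bar>y - x\<bar> - norm D)
      \<le> norm ((f y - f x) - (y - x) *\<^sub>R D) / norm (y - x)"
    using eventually_neq_at_within[of x x UNIV]
  proof eventually_elim
    case (elim y)
    have "\<bar>norm (f y - f x) - norm ((y - x) *\<^sub>R D)\<bar> \<le> norm ((f y - f x) - (y - x) *\<^sub>R D)"
      by (rule norm_triangle_ineq3)
    then have "\<bar>norm (f y - f x) - \<bar>y - x\<bar> * norm D\<bar> / \<bar>y - x\<bar> \<le> norm ((f y - f x) - (y - x) *\<^sub>R D) / \<bar>y - x\<bar>"
      by (intro divide_right_mono) auto
    moreover have "norm (f y - f x) / \<bar>y - x\<bar> - norm D = (norm (f y - f x) - \<bar>y - x\<bar> * norm D) / \<bar>y - x\<bar>"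
      using elim by (simp add: diff_divide_distrib)
    ultimately show ?case by (simp add: abs_divide)
  qed
  ultimately have "((\<lambda>y. norm (f y - f x) / \<bar>y - x\<bar> - norm D) \<longlongrightarrow> 0) (at x)"
    by (rule Lim_null_comparison[rotated])
  then show ?thesis by (rule LIM_zero_cancel)
qed

locale curve_shift = jordan_curve +
  fixes \<alpha> :: "complex \<Rightarrow> complex"
  assumes diffeo: "curve_diffeo \<Gamma> \<alpha>"
    and orient: "orientation_preserving \<gamma> \<alpha>"
    and fixpts: "{\<tau> \<in> \<Gamma>. \<alpha> \<tau> = \<tau>} \<noteq> {}"
begin

definition jac :: "complex \<Rightarrow> real" where
  "jac \<tau> = cmod (curve_deriv \<Gamma> \<alpha> \<tau>)"

lemma bij: "bij_betw \<alpha> \<Gamma> \<Gamma>"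
  using diffeo unfolding curve_diffeo_def by blast

lemma maps: "\<tau> \<in> \<Gamma> \<Longrightarrow> \<alpha> \<tau> \<in> \<Gamma>"
  using bij by (rule bij_betwE[rule_format])

lemma maps_iter: "\<tau> \<in> \<Gamma> \<Longrightarrow> (\<alpha> ^^ n) \<tau> \<in> \<Gamma>"
  by (induction n) (auto intro: maps)

text \<open>A connected set with more than one point has no isolated points. This makes derivatives
  along the curve unique, so that the \<open>THE\<close> in \<open>curve_deriv\<close> is
  meaningful.\<close>

lemma within_curve_nontrivial:
  assumes "\<tau> \<in> \<Gamma>"
  shows "at \<tau> within \<Gamma> \<noteq> bot"
proof -
  have "connected \<Gamma>" unfolding curve_set_def by (intro connected_continuous_image cont connected_Icc)
  moreover have "\<Gamma> \<noteq> {x}" for x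
  proof
    assume "\<Gamma> = {x}"
    then have "\<gamma> 0 = \<gamma> (L / 2)" using gamma_in[of 0] gamma_in[of "L / 2"] by simp
    then show False using inj_onD[OF inj, of 0 "L / 2"] L_pos by simp
  qed
  ultimately have "\<tau> islimpt \<Gamma>" using assms by (intro connected_imp_perfect)
  then show ?thesis by (simp add: trivial_limit_within)
qed

lemma within_deriv_unique:
  assumes "\<tau> \<in> \<Gamma>" "(f has_field_derivative d) (at \<tau> within \<Gamma>)" "(f has_field_derivative e) (at \<tau> within \<Gamma>)"
  shows "d = e"
  using assms(2,3) unfolding has_field_derivative_iff
  by (rule tendsto_unique[OF within_curve_nontrivial[OF assms(1)]])

lemma curve_deriv_eq:
  assumes "\<tau> \<in> \<Gamma>" "(f has_field_derivative d) (at \<tau> within \<Gamma>)"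
  shows "curve_deriv \<Gamma> f \<tau> = d"
  unfolding curve_deriv_def using assms by (intro the_equality) (auto intro: within_deriv_unique)

lemma
  shows alpha_has_deriv: "\<tau> \<in> \<Gamma> \<Longrightarrow> (\<alpha> has_field_derivative curve_deriv \<Gamma> \<alpha> \<tau>) (at \<tau> within \<Gamma>)"
    and alpha_deriv_cont: "continuous_on \<Gamma> (curve_deriv \<Gamma> \<alpha>)"
proof -
  obtain f' where f': "\<forall>\<tau>\<in>\<Gamma>. (\<alpha> has_field_derivative f' \<tau>) (at \<tau> within \<Gamma>)" "continuous_on \<Gamma> f'"
    using diffeo unfolding curve_diffeo_def curve_C1_def by blast
  have eq: "curve_deriv \<Gamma> \<alpha> \<tau> = f' \<tau>" if "\<tau> \<in> \<Gamma>" for \<tau>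
    using curve_deriv_eq[OF that] f'(1) that by blast
  show "\<tau> \<in> \<Gamma> \<Longrightarrow> (\<alpha> has_field_derivative curve_deriv \<Gamma> \<alpha> \<tau>) (at \<tau> within \<Gamma>)"
    using eq f'(1) by simp
  show "continuous_on \<Gamma> (curve_deriv \<Gamma> \<alpha>)"
    by (rule continuous_on_eq[OF f'(2)]) (simp add: eq)
qed

lemma jac_cont: "continuous_on \<Gamma> jac"
  unfolding jac_def by (intro continuous_on_norm alpha_deriv_cont)

lemma alpha_cont: "continuous_on \<Gamma> \<alpha>"
  using alpha_has_deriv by (rule DERIV_continuous_on)

text \<open>The inverse map is differentiable too, and the chain rule makes the two derivatives
  multiply to 1.\<close>

lemma jac_pos:
  assumes \<tau>: "\<tau> \<in> \<Gamma>"
  shows "jac \<tau> > 0"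
proof -
  let ?\<beta> = "the_inv_into \<Gamma> \<alpha>"
  obtain f' where f': "\<forall>\<tau>\<in>\<Gamma>. (?\<beta> has_field_derivative f' \<tau>) (at \<tau> within \<Gamma>)"
    using diffeo unfolding curve_diffeo_def curve_C1_def by blast
  have "\<alpha> ` \<Gamma> = \<Gamma>" using bij by (rule bij_betw_imp_surj_on)
  then have "(?\<beta> has_field_derivative f' (\<alpha> \<tau>)) (at (\<alpha> \<tau>) within \<alpha> ` \<Gamma>)"
    using f' maps[OF \<tau>] by simp
  from DERIV_image_chain[OF this alpha_has_deriv[OF \<tau>]]
  have "(?\<beta> \<circ> \<alpha> has_field_derivative f' (\<alpha> \<tau>) * curve_deriv \<Gamma> \<alpha> \<tau>) (at \<tau> within \<Gamma>)" .
  moreover have "(?\<beta> \<circ> \<alpha> has_field_derivative 1) (at \<tau> within \<Gamma>)"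
  proof (rule has_field_derivative_transform_within[OF DERIV_ident zero_less_one \<tau>])
    fix x assume "x \<in> \<Gamma>"
    then show "x = (?\<beta> \<circ> \<alpha>) x" using bij by (simp add: bij_betw_def the_inv_into_f_f)
  qed
  ultimately have "f' (\<alpha> \<tau>) * curve_deriv \<Gamma> \<alpha> \<tau> = 1" by (rule within_deriv_unique[OF \<tau>])
  then show ?thesis by (auto simp: jac_def)
qed

lemma alpha_measurable: "\<alpha> \<in> measurable M M"
proof -
  have "\<alpha> \<in> measurable (restrict_space borel \<Gamma>) (restrict_space borel \<Gamma>)"
    by (rule measurable_restrict_space2)
      (auto simp: space_restrict_space maps intro: borel_measurable_continuous_on_restrict alpha_cont)
  then show ?thesis unfolding measurable_cong_sets[OF sets_M sets_M] .
qed

lemma alpha_iter_measurable: "(\<alpha> ^^ n) \<in> measurable M M"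
proof (induction n)
  case (Suc n)
  show ?case unfolding funpow.simps by (rule measurable_comp[OF Suc alpha_measurable])
qed simp

lemma continuous_measurable:
  fixes f :: "complex \<Rightarrow> 'b::topological_space"
  assumes "continuous_on \<Gamma> f"
  shows "f \<in> borel_measurable M"
proof -
  have "f \<in> borel_measurable (restrict_space borel \<Gamma>)"
    by (rule borel_measurable_continuous_on_restrict[OF assms])
  then show ?thesis unfolding measurable_cong_sets[OF sets_M refl] .
qed

text \<open>A fixed point pins down the lift: it can be chosen to fix the coordinate
  \<open>s0\<close>, and injectivity of \<alpha> together with monotonicity makes it advance by
  exactly one period. The lift thus maps \<open>{s0..s0 + L}\<close> to itself with fixed
  ends.\<close>

lemma normalized_lift:
  "\<exists>\<phi> s0. s0 \<in> {0..<L} \<and> continuous_on UNIV \<phi> \<and> strict_mono \<phi> \<and> (\<forall>s. \<alpha> (\<gamma> s) = \<gamma> (\<phi> s)) \<and>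
     \<phi> s0 = s0 \<and> \<phi> (s0 + L) = s0 + L"
proof -
  obtain \<psi> :: "real \<Rightarrow> real" where \<psi>: "continuous_on UNIV \<psi>" "strict_mono \<psi>" "\<And>s. \<alpha> (\<gamma> s) = \<gamma> (\<psi> s)"
    using orient unfolding orientation_preserving_def by blast
  obtain \<tau> where \<tau>: "\<tau> \<in> \<Gamma>" "\<alpha> \<tau> = \<tau>" using fixpts by blast
  define s0 where "s0 = coord \<tau>"
  have s0: "s0 \<in> {0..<L}" "\<gamma> s0 = \<tau>" using coord_in gamma_coord \<tau> by (auto simp: s0_def)
  have "\<gamma> s0 = \<gamma> (\<psi> s0)" using \<psi>(3)[of s0] \<tau> s0 by simp
  then obtain k where k: "\<psi> s0 = s0 + of_int k * L" by (rule gamma_eqD)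
  define \<phi> where "\<phi> s = \<psi> s - of_int k * L" for s
  have \<phi>c: "continuous_on UNIV \<phi>" unfolding \<phi>_def by (intro continuous_intros \<psi>)
  have \<phi>m: "strict_mono \<phi>" using \<psi>(2) by (auto simp: \<phi>_def strict_mono_def)
  have \<phi>l: "\<alpha> (\<gamma> s) = \<gamma> (\<phi> s)" for s
    using periodic_int[of "\<psi> s" "- k"] \<psi>(3) by (simp add: \<phi>_def)
  have \<phi>0: "\<phi> s0 = s0" using k by (simp add: \<phi>_def)
  have "\<gamma> s0 = \<gamma> (\<phi> (s0 + L))" using \<phi>l[of "s0 + L"] \<phi>l[of s0] periodic[of s0] \<phi>0 by simp
  then obtain j where j: "\<phi> (s0 + L) = s0 + of_int j * L" by (rule gamma_eqD)
  have "\<phi> s0 < \<phi> (s0 + L)" using \<phi>m L_pos by (simp add: strict_mono_def)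
  then have "0 < of_int j * L" using j \<phi>0 by simp
  then have "j > 0" using L_pos by (simp add: zero_less_mult_iff)
  \<comment> \<open>Winding more than once would make the lift reach \<open>s0 + L\<close> strictly
    before the end of the period, so \<alpha> would take the value at the fixed point twice.\<close>
  moreover have "\<not> j > 1"
  proof
    assume "j > 1"
    then have "1 * L < of_int j * L" using L_pos by (intro mult_strict_right_mono) auto
    then have *: "s0 + L < \<phi> (s0 + L)" using j by simp
    have "\<exists>t\<ge>s0. t \<le> s0 + L \<and> \<phi> t = s0 + L"
      using * \<phi>0 L_pos \<phi>c by (intro IVT') (auto intro: continuous_on_subset)
    then obtain t where t: "s0 \<le> t" "t \<le> s0 + L" "\<phi> t = s0 + L" by blast
    have "t \<noteq> s0" "t \<noteq> s0 + L" using t \<phi>0 * L_pos by auto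
    then have t': "s0 < t" "t < s0 + L" using t by auto
    have "\<alpha> (\<gamma> t) = \<alpha> (\<gamma> s0)" using \<phi>l t(3) periodic[of s0] \<phi>0 by simp
    then have "\<gamma> s0 = \<gamma> t" using bij gamma_in by (metis bij_betw_imp_inj_on inj_onD)
    then obtain i where i: "t = s0 + of_int i * L" by (rule gamma_eqD)
    then have "0 < of_int i * L" "of_int i * L < 1 * L" using t' by auto
    then have "0 < i" "i < 1"
      using L_pos by (auto simp: zero_less_mult_iff)
    then show False by simp
  qed
  ultimately have "j = 1" by simp
  then have "\<phi> (s0 + L) = s0 + L" using j by simp
  with s0 \<phi>c \<phi>m \<phi>l \<phi>0 show ?thesis by blast
qed

text \<open>The lift is only known to be continuous and increasing. Its difference quotient is
  recovered by dividing secant lengths of \<alpha> along the curve by secant lengths of \<gamma> at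
  the image point.\<close>

lemma lift_deriv:
  assumes \<phi>: "continuous_on UNIV \<phi>" "strict_mono \<phi>" "\<And>s. \<alpha> (\<gamma> s) = \<gamma> (\<phi> s)"
  shows "(\<phi> has_real_derivative jac (\<gamma> s)) (at s)"
proof -
  obtain \<gamma>' where \<gamma>': "\<forall>s. (\<gamma> has_vector_derivative \<gamma>' s) (at s)" "\<forall>s. norm (\<gamma>' s) = 1"
    using tangent by blast
  have "range \<gamma> = \<Gamma>" using curve_set_eq gamma_in by auto
  then have "(\<alpha> \<circ> \<gamma> has_vector_derivative \<gamma>' s * curve_deriv \<Gamma> \<alpha> (\<gamma> s)) (at s)"
    using \<gamma>'(1) alpha_has_deriv[OF gamma_in] by (intro field_vector_diff_chain_within) auto
  from has_vector_derivative_norm_quotient[OF this]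
  have P: "((\<lambda>y. norm (\<gamma> (\<phi> y) - \<gamma> (\<phi> s)) / \<bar>y - s\<bar>) \<longlongrightarrow> jac (\<gamma> s)) (at s)"
    using \<gamma>'(2) by (simp add: \<phi>(3) norm_mult jac_def)
  have "((\<lambda>y. norm (\<gamma> y - \<gamma> (\<phi> s)) / \<bar>y - \<phi> s\<bar>) \<longlongrightarrow> 1) (at (\<phi> s))"
    using has_vector_derivative_norm_quotient[OF \<gamma>'(1)[rule_format, of "\<phi> s"]] \<gamma>'(2) by simp
  moreover have "filterlim \<phi> (at (\<phi> s)) (at s)"
  proof (rule filterlim_atI)
    show "(\<phi> \<longlongrightarrow> \<phi> s) (at s)" using \<phi>(1) by (simp add: continuous_on_eq_continuous_at continuous_at)
    show "\<forall>\<^sub>F y in at s. \<phi> y \<noteq> \<phi> s"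
      using eventually_neq_at_within[of s s UNIV]
      by eventually_elim (use \<phi>(2) in \<open>simp add: strict_mono_eq\<close>)
  qed
  \<comment> \<open>Unit speed gives the limit 1, so this quotient is eventually nonzero and can be
    divided out. The remaining absolute values disappear because the lift is increasing.\<close>
  ultimately have R: "((\<lambda>y. norm (\<gamma> (\<phi> y) - \<gamma> (\<phi> s)) / \<bar>\<phi> y - \<phi> s\<bar>) \<longlongrightarrow> 1) (at s)"
    by (rule filterlim_compose)
  have "((\<lambda>y. (norm (\<gamma> (\<phi> y) - \<gamma> (\<phi> s)) / \<bar>y - s\<bar>) / (norm (\<gamma> (\<phi> y) - \<gamma> (\<phi> s)) / \<bar>\<phi> y - \<phi> s\<bar>))
      \<longlongrightarrow> jac (\<gamma> s) / 1) (at s)"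
    by (intro tendsto_divide P R) simp
  moreover have "\<forall>\<^sub>F y in at s. (norm (\<gamma> (\<phi> y) - \<gamma> (\<phi> s)) / \<bar>y - s\<bar>) / (norm (\<gamma> (\<phi> y) - \<gamma> (\<phi> s)) / \<bar>\<phi> y - \<phi> s\<bar>)
      = (\<phi> y - \<phi> s) / (y - s)"
  proof -
    have "\<forall>\<^sub>F y in at s. norm (\<gamma> (\<phi> y) - \<gamma> (\<phi> s)) / \<bar>\<phi> y - \<phi> s\<bar> > 0"
      using R by (rule order_tendstoD) simp
    then show ?thesis
      using eventually_neq_at_within[of s s UNIV]
    proof eventually_elim
      case (elim y)
      then have "norm (\<gamma> (\<phi> y) - \<gamma> (\<phi> s)) \<noteq> 0" by auto
      moreover have "\<bar>\<phi> y - \<phi> s\<bar> / \<bar>y - s\<bar> = (\<phi> y - \<phi> s) / (y - s)"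
        using \<phi>(2) elim by (cases "y < s") (auto simp: strict_mono_less abs_if divide_simps algebra_simps)
      ultimately show ?case by (simp add: field_simps)
    qed
  qed
  ultimately have "((\<lambda>y. (\<phi> y - \<phi> s) / (y - s)) \<longlongrightarrow> jac (\<gamma> s) / 1) (at s)"
    by (rule Lim_transform_eventually)
  then show ?thesis unfolding has_field_derivative_iff by simp
qed

text \<open>The substitution has to take place on the interval preserved by the lift. The piece
  before \<open>s0\<close> is moved by one period, and the extra end point is null.\<close>

lemma nn_integral_period:
  assumes F: "F \<in> borel_measurable M" and s0: "s0 \<in> {0..<L}"
  shows "(\<integral>\<^sup>+x. F x \<partial>M) = (\<integral>\<^sup>+s. F (\<gamma> s) * indicator {s0..s0 + L} s \<partial>lborel)"
proof -
  from measurable_compose[OF gamma_measurable_borel F]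
  have f [measurable]: "(\<lambda>s. F (\<gamma> s)) \<in> borel_measurable borel" .
  have "(\<integral>\<^sup>+x. F x \<partial>M) = (\<integral>\<^sup>+s. F (\<gamma> s) * indicator {0..<L} s \<partial>lborel)" by (rule nn_integral_M[OF F])
  also have "\<dots> = (\<integral>\<^sup>+s. F (\<gamma> s) * indicator {0..<s0} s + F (\<gamma> s) * indicator {s0..<L} s \<partial>lborel)"
    by (intro nn_integral_cong) (use s0 in \<open>auto split: split_indicator\<close>)
  also have "\<dots> = (\<integral>\<^sup>+s. F (\<gamma> s) * indicator {0..<s0} s \<partial>lborel) + (\<integral>\<^sup>+s. F (\<gamma> s) * indicator {s0..<L} s \<partial>lborel)"
    by (intro nn_integral_add) auto
  also have "(\<integral>\<^sup>+s. F (\<gamma> s) * indicator {0..<s0} s \<partial>lborel) = (\<integral>\<^sup>+s. F (\<gamma> s) * indicator {L..<s0 + L} s \<partial>lborel)"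
  proof -
    have "(\<integral>\<^sup>+s. F (\<gamma> s) * indicator {L..<s0 + L} s \<partial>lborel)
        = ennreal \<bar>1\<bar> * (\<integral>\<^sup>+s. F (\<gamma> (L + 1 * s)) * indicator {L..<s0 + L} (L + 1 * s) \<partial>lborel)"
      by (rule nn_integral_real_affine) auto
    also have "(\<integral>\<^sup>+s. F (\<gamma> (L + 1 * s)) * indicator {L..<s0 + L} (L + 1 * s) \<partial>lborel)
        = (\<integral>\<^sup>+s. F (\<gamma> s) * indicator {0..<s0} s \<partial>lborel)"
      by (intro nn_integral_cong) (auto split: split_indicator simp: periodic add.commute[of L])
    finally show ?thesis by simp
  qed
  also have "(\<integral>\<^sup>+s. F (\<gamma> s) * indicator {L..<s0 + L} s \<partial>lborel) + (\<integral>\<^sup>+s. F (\<gamma> s) * indicator {s0..<L} s \<partial>lborel)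
      = (\<integral>\<^sup>+s. F (\<gamma> s) * indicator {L..<s0 + L} s + F (\<gamma> s) * indicator {s0..<L} s \<partial>lborel)"
    by (intro nn_integral_add[symmetric]) auto
  also have "\<dots> = (\<integral>\<^sup>+s. F (\<gamma> s) * indicator {s0..s0 + L} s \<partial>lborel)"
  proof (rule nn_integral_cong_AE)
    have "AE s in lborel. s \<noteq> s0 + L" by (rule AE_lborel_singleton)
    then show "AE s in lborel. F (\<gamma> s) * indicator {L..<s0 + L} s + F (\<gamma> s) * indicator {s0..<L} s
        = F (\<gamma> s) * indicator {s0..s0 + L} s"
      by eventually_elim (use s0 in \<open>auto split: split_indicator\<close>)
  qed
  finally show ?thesis .
qed

text \<open>Integration by substitution along the lift, whose derivative is \<open>jac\<close> and
  which fixes both ends of the period interval.\<close>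

lemma nn_integral_shift:
  assumes F: "F \<in> borel_measurable M"
  shows "(\<integral>\<^sup>+x. F (\<alpha> x) * ennreal (jac x) \<partial>M) = (\<integral>\<^sup>+x. F x \<partial>M)"
proof -
  obtain \<phi> s0 where \<phi>: "continuous_on UNIV \<phi>" "strict_mono \<phi>" "\<And>s. \<alpha> (\<gamma> s) = \<gamma> (\<phi> s)"
    and s0: "s0 \<in> {0..<L}" "\<phi> s0 = s0" "\<phi> (s0 + L) = s0 + L"
    using normalized_lift by blast
  from measurable_compose[OF gamma_measurable_borel F]
  have f: "(\<lambda>s. F (\<gamma> s)) \<in> borel_measurable borel" .
  note [measurable] = measurable_compose[OF alpha_measurable F] continuous_measurable[OF jac_cont]
  have "(\<integral>\<^sup>+x. F (\<alpha> x) * ennreal (jac x) \<partial>M)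
      = (\<integral>\<^sup>+s. F (\<alpha> (\<gamma> s)) * ennreal (jac (\<gamma> s)) * indicator {s0..s0 + L} s \<partial>lborel)"
    by (rule nn_integral_period[OF _ s0(1)]) measurable
  also have "\<dots> = (\<integral>\<^sup>+s. F (\<gamma> (\<phi> s)) * ennreal (jac (\<gamma> s)) * indicator {s0..s0 + L} s \<partial>lborel)"
    by (simp add: \<phi>(3))
  also have "\<dots> = (\<integral>\<^sup>+s. F (\<gamma> s) * indicator {\<phi> s0..\<phi> (s0 + L)} s \<partial>lborel)"
  proof (rule nn_integral_substitution_aux[symmetric, OF f])
    show "(\<phi> has_real_derivative jac (\<gamma> s)) (at s)" for s by (rule lift_deriv[OF \<phi>])
    show "continuous_on {s0..s0 + L} (\<lambda>s. jac (\<gamma> s))"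
      by (rule continuous_on_compose2[OF jac_cont cont]) (auto simp: gamma_in)
  qed (use L_pos in \<open>auto simp: jac_def\<close>)
  also have "\<dots> = (\<integral>\<^sup>+x. F x \<partial>M)" unfolding s0 by (rule nn_integral_period[OF F s0(1), symmetric])
  finally show ?thesis .
qed

text \<open>The product of \<open>jac\<close> along the orbit acts as the Jacobian of the iterate;
  iterating the substitution avoids differentiating the iterate.\<close>

lemma nn_integral_shift_iter:
  assumes F: "F \<in> borel_measurable M"
  shows "(\<integral>\<^sup>+x. F ((\<alpha> ^^ n) x) * ennreal (\<Prod>j<n. jac ((\<alpha> ^^ j) x)) \<partial>M) = (\<integral>\<^sup>+x. F x \<partial>M)"
proof (induction n)
  case (Suc n)
  note [measurable] = alpha_iter_measurable F continuous_measurable[OF jac_cont]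
  define G where "G x = F ((\<alpha> ^^ n) x) * ennreal (\<Prod>j<n. jac ((\<alpha> ^^ j) x))" for x
  have "(\<integral>\<^sup>+x. F ((\<alpha> ^^ Suc n) x) * ennreal (\<Prod>j<Suc n. jac ((\<alpha> ^^ j) x)) \<partial>M)
      = (\<integral>\<^sup>+x. G (\<alpha> x) * ennreal (jac x) \<partial>M)"
  proof (rule nn_integral_cong)
    fix x
    have "ennreal (\<Prod>j<Suc n. jac ((\<alpha> ^^ j) x)) = ennreal (jac x) * ennreal (\<Prod>j<n. jac ((\<alpha> ^^ j) (\<alpha> x)))"
      unfolding prod.lessThan_Suc_shift funpow_Suc_right comp_apply
      by (subst ennreal_mult[symmetric]) (auto simp: jac_def intro: prod_nonneg)
    then show "F ((\<alpha> ^^ Suc n) x) * ennreal (\<Prod>j<Suc n. jac ((\<alpha> ^^ j) x)) = G (\<alpha> x) * ennreal (jac x)"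
      unfolding G_def funpow_Suc_right comp_apply by (simp only: mult_ac)
  qed
  also have "\<dots> = (\<integral>\<^sup>+x. G x \<partial>M)"
    by (rule nn_integral_shift) (unfold G_def, measurable)
  finally show ?case using Suc by (simp add: G_def)
qed simp

text \<open>The lift fixes \<open>s0\<close> and \<open>s0 + L\<close>, so its orbits are monotone and have total variation at
  most \<open>L\<close>, while every step taken off a neighbourhood of the fixed points has length bounded below.\<close>

lemma few_visits_off_fixed_points:
  assumes w: "continuous_on \<Gamma> w" and wq: "\<And>\<tau>. \<tau> \<in> \<Gamma> \<Longrightarrow> \<alpha> \<tau> = \<tau> \<Longrightarrow> w \<tau> < (q::real)"
  obtains N where "\<And>\<tau> n. \<tau> \<in> \<Gamma> \<Longrightarrow> card {j. j < n \<and> q \<le> w ((\<alpha> ^^ j) \<tau>)} \<le> N"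
proof -
  obtain \<phi> s0 where \<phi>: "continuous_on UNIV \<phi>" "strict_mono \<phi>" "\<And>s. \<alpha> (\<gamma> s) = \<gamma> (\<phi> s)"
    and s0: "s0 \<in> {0..<L}" "\<phi> s0 = s0" "\<phi> (s0 + L) = s0 + L"
    using normalized_lift by blast
  have iter: "(\<alpha> ^^ j) (\<gamma> s) = \<gamma> ((\<phi> ^^ j) s)" for j s
    by (induction j) (auto simp: \<phi>(3))
  have \<phi>I: "\<phi> s \<in> {s0..s0 + L}" if "s \<in> {s0..s0 + L}" for s
    using that strict_mono_less_eq[OF \<phi>(2), of s0 s] strict_mono_less_eq[OF \<phi>(2), of s "s0 + L"] s0 by simp
  have \<phi>nI: "(\<phi> ^^ j) s \<in> {s0..s0 + L}" if "s \<in> {s0..s0 + L}" for s j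
    by (induction j) (use that \<phi>I in \<open>simp_all del: atLeastAtMost_iff\<close>)
  define K where "K = {s \<in> {s0..s0 + L}. q \<le> w (\<gamma> s)}"
  have "compact K"
  proof -
    have "continuous_on {s0..s0 + L} (\<lambda>s. w (\<gamma> s))"
      by (rule continuous_on_compose2[OF w cont]) (auto simp: gamma_in)
    then have "closed ({s0..s0 + L} \<inter> (\<lambda>s. w (\<gamma> s)) -` {q..})"
      by (rule continuous_closed_preimage) auto
    then have "compact ({s0..s0 + L} \<inter> ({s0..s0 + L} \<inter> (\<lambda>s. w (\<gamma> s)) -` {q..}))"
      by (rule compact_Int_closed[OF compact_Icc])
    moreover have "{s0..s0 + L} \<inter> ({s0..s0 + L} \<inter> (\<lambda>s. w (\<gamma> s)) -` {q..}) = K"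
      unfolding K_def by auto
    ultimately show ?thesis by simp
  qed
  \<comment> \<open>A fixed point of the lift lies over a fixed point of \<alpha>, where
    \<open>w < q\<close>. So the displacement has no zero on the compact set \<open>K\<close>, and
    its minimum there is positive.\<close>
  obtain c where c: "c > 0" "\<And>s. s \<in> K \<Longrightarrow> c \<le> \<bar>\<phi> s - s\<bar>"
  proof (cases "K = {}")
    case True
    then show thesis using that[of 1] by simp
  next
    case False
    have "continuous_on K (\<lambda>s. \<bar>\<phi> s - s\<bar>)"
      by (intro continuous_intros continuous_on_subset[OF \<phi>(1)]) simp
    from continuous_attains_inf[OF \<open>compact K\<close> False this]
    obtain s where s: "s \<in> K" "\<forall>t\<in>K. \<bar>\<phi> s - s\<bar> \<le> \<bar>\<phi> t - t\<bar>" by blast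
    have "\<phi> s \<noteq> s"
    proof
      assume "\<phi> s = s"
      then have "\<alpha> (\<gamma> s) = \<gamma> s" using \<phi>(3)[of s] by simp
      from wq[OF gamma_in this] show False using s(1) by (simp add: K_def)
    qed
    then show thesis using s that[of "\<bar>\<phi> s - s\<bar>"] by simp
  qed
  show thesis
  proof (rule that[of "nat \<lceil>L / c\<rceil>"])
    fix \<tau> n assume \<tau>: "\<tau> \<in> \<Gamma>"
    obtain s where s: "s \<in> {s0..s0 + L}" "\<gamma> s = \<tau>"
    proof (cases "coord \<tau> \<ge> s0")
      case True
      then show thesis using that[of "coord \<tau>"] gamma_coord[OF \<tau>] coord_in[OF \<tau>] s0(1) by simp
    next
      case False
      then show thesis using that[of "coord \<tau> + L"] gamma_coord[OF \<tau>] coord_in[OF \<tau>] s0(1) periodic by simp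
    qed
    define x where "x j = (\<phi> ^^ j) s" for j
    have xS: "x (Suc j) = \<phi> (x j)" for j by (simp add: x_def)
    have xI: "x j \<in> {s0..s0 + L}" for j unfolding x_def by (rule \<phi>nI[OF s(1)])
    define J where "J = {j. j < n \<and> q \<le> w ((\<alpha> ^^ j) \<tau>)}"
    have J: "finite J" "J \<subseteq> {..<n}" by (auto simp: J_def)
    have "real (card J) * c = (\<Sum>j\<in>J. c)" by simp
    also have "\<dots> \<le> (\<Sum>j\<in>J. \<bar>x (Suc j) - x j\<bar>)"
    proof (rule sum_mono)
      fix j assume "j \<in> J"
      then have "q \<le> w (\<gamma> (x j))" using iter[of j s] s(2) by (simp add: J_def x_def)
      then have "x j \<in> K" using xI by (simp add: K_def)
      then show "c \<le> \<bar>x (Suc j) - x j\<bar>" unfolding xS by (rule c)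
    qed
    also have "\<dots> \<le> (\<Sum>j<n. \<bar>x (Suc j) - x j\<bar>)" using J by (intro sum_mono2) auto
    also have "\<dots> \<le> L"
    \<comment> \<open>The direction of the first step persists because the lift is increasing, and
      the variation telescopes to the distance between two points of one period.\<close>
    proof (cases "\<phi> s \<ge> s")
      case True
      have "x j \<le> x (Suc j)" for j
      proof (induction j)
        case (Suc j)
        then show ?case unfolding xS[of "Suc j"] using xS[of j] by (simp add: strict_mono_less_eq[OF \<phi>(2)])
      qed (use True in \<open>simp add: x_def\<close>)
      then have "(\<Sum>j<n. \<bar>x (Suc j) - x j\<bar>) = (\<Sum>j<n. x (Suc j) - x j)" by simp
      also have "\<dots> = x n - x 0" by (rule sum_lessThan_telescope)
      finally show ?thesis using xI[of n] xI[of 0] by simp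
    next
      case False
      have "x (Suc j) \<le> x j" for j
      proof (induction j)
        case (Suc j)
        then show ?case unfolding xS[of "Suc j"] using xS[of j] by (simp add: strict_mono_less_eq[OF \<phi>(2)])
      qed (use False in \<open>simp add: x_def\<close>)
      then have "(\<Sum>j<n. \<bar>x (Suc j) - x j\<bar>) = (\<Sum>j<n. x j - x (Suc j))" by simp
      also have "\<dots> = x 0 - x n" by (rule sum_lessThan_telescope')
      finally show ?thesis using xI[of n] xI[of 0] by simp
    qed
    finally have "real (card J) \<le> L / c" using c(1) by (simp add: pos_le_divide_eq)
    then show "card J \<le> nat \<lceil>L / c\<rceil>" by linarith
  qed
qed

text \<open>All but \<open>N\<close> factors are below \<open>q\<close>. Each exceptional one is at
  most \<open>R * q\<close> with \<open>R \<ge> 1\<close>, so the excess over \<open>q ^ n\<close>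
  is at most \<open>R ^ N\<close>, uniformly in the orbit and in \<open>n\<close>.\<close>

lemma orbit_product_bound:
  assumes w: "continuous_on \<Gamma> w" and w0: "\<And>\<tau>. \<tau> \<in> \<Gamma> \<Longrightarrow> 0 \<le> w \<tau>" and q: "q > 0"
    and wq: "\<And>\<tau>. \<tau> \<in> \<Gamma> \<Longrightarrow> \<alpha> \<tau> = \<tau> \<Longrightarrow> w \<tau> < (q::real)"
  obtains C where "C > 0" "\<And>\<tau> n. \<tau> \<in> \<Gamma> \<Longrightarrow> (\<Prod>j<n. w ((\<alpha> ^^ j) \<tau>)) \<le> C * q ^ n"
proof -
  obtain N where N: "\<And>\<tau> n. \<tau> \<in> \<Gamma> \<Longrightarrow> card {j. j < n \<and> q \<le> w ((\<alpha> ^^ j) \<tau>)} \<le> N"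
    using few_visits_off_fixed_points[OF w wq] by blast
  have "compact (w ` \<Gamma>)" by (rule compact_continuous_image[OF w compact_curve])
  then obtain B where B: "\<And>\<tau>. \<tau> \<in> \<Gamma> \<Longrightarrow> w \<tau> \<le> B"
    using compact_imp_bounded bounded_real by (metis abs_le_D1 imageI)
  define R where "R = max 1 (B / q)"
  show thesis
  proof (rule that[of "R ^ N"])
    show "R ^ N > 0" by (simp add: R_def)
    fix \<tau> n assume \<tau>: "\<tau> \<in> \<Gamma>"
    have "(\<Prod>j<n. w ((\<alpha> ^^ j) \<tau>)) \<le> (\<Prod>j<n. (if q \<le> w ((\<alpha> ^^ j) \<tau>) then R else 1) * q)"
    proof (intro prod_mono conjI w0 maps_iter \<tau>)
      fix j
      have "w ((\<alpha> ^^ j) \<tau>) \<le> B" by (intro B maps_iter \<tau>)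
      also have "B \<le> R * q" using q by (simp add: R_def max_def field_simps)
      finally show "w ((\<alpha> ^^ j) \<tau>) \<le> (if q \<le> w ((\<alpha> ^^ j) \<tau>) then R else 1) * q" by simp
    qed
    also have "\<dots> = R ^ card {j. j < n \<and> q \<le> w ((\<alpha> ^^ j) \<tau>)} * q ^ n"
      by (simp add: prod.distrib prod.If_cases Int_def lessThan_def)
    also have "\<dots> \<le> R ^ N * q ^ n"
      using q N[OF \<tau>, of n] by (intro mult_right_mono power_increasing) (auto simp: R_def)
    finally show "(\<Prod>j<n. w ((\<alpha> ^^ j) \<tau>)) \<le> R ^ N * q ^ n" .
  qed
qed

end

section \<open>Norms of the iterates of the weighted shift\<close>

text \<open>The exponents are negated because a Jacobian \<open>x\<close> corresponds to dilation
  norm at \<open>1 / x\<close>: for positive \<open>x\<close> this is the growth bound of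
  \<open>dilation_norm\<close> there, up to a constant.\<close>

definition two_power_max :: "real \<Rightarrow> real \<Rightarrow> real \<Rightarrow> real" where
  "two_power_max a b x = max (x powr (- a)) (x powr (- b))"

lemma two_power_max_pos: "x > 0 \<Longrightarrow> two_power_max a b x > 0"
  by (simp add: two_power_max_def less_max_iff_disj)

lemma two_power_max_mult:
  assumes "x > 0" "y > 0"
  shows "two_power_max a b (x * y) \<le> two_power_max a b x * two_power_max a b y"
proof -
  have "(x * y) powr (- c) \<le> two_power_max a b x * two_power_max a b y" if "c = a \<or> c = b" for c
  proof -
    have "(x * y) powr (- c) = x powr (- c) * y powr (- c)" using assms by (simp add: powr_mult)
    also have "\<dots> \<le> two_power_max a b x * two_power_max a b y"
      using that by (intro mult_mono) (auto simp: two_power_max_def le_max_iff_disj)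
    finally show ?thesis .
  qed
  then show ?thesis unfolding two_power_max_def[of a b "x * y"] by simp
qed

lemma two_power_max_prod:
  assumes "finite I" "\<And>i. i \<in> I \<Longrightarrow> x i > 0"
  shows "two_power_max a b (\<Prod>i\<in>I. x i) \<le> (\<Prod>i\<in>I. two_power_max a b (x i))"
  using assms
proof (induction I rule: finite_induct)
  case empty
  then show ?case by (simp add: two_power_max_def)
next
  case (insert i I)
  have "two_power_max a b (x i * (\<Prod>i\<in>I. x i)) \<le> two_power_max a b (x i) * two_power_max a b (\<Prod>i\<in>I. x i)"
    using insert by (intro two_power_max_mult prod_pos) auto
  also have "\<dots> \<le> two_power_max a b (x i) * (\<Prod>i\<in>I. two_power_max a b (x i))"
    using insert two_power_max_pos[of "x i" a b] by (intro mult_left_mono) (auto intro: less_imp_le)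
  finally show ?case using insert by simp
qed

text \<open>Rounding a Jacobian down to an integer power of \<open>e\<close> changes it by a factor
  between \<open>exp (- 1)\<close> and 1, which costs at most a constant in the weight.\<close>

lemma two_power_max_floor:
  assumes "D > 0"
  shows "two_power_max a b (exp (of_int \<lfloor>ln D\<rfloor>)) \<le> two_power_max a b D * exp (\<bar>a\<bar> + \<bar>b\<bar>)"
proof -
  define y where "y = ln D - of_int \<lfloor>ln D\<rfloor>"
  have y: "0 \<le> y" "y \<le> 1" unfolding y_def by linarith+
  have "exp (of_int \<lfloor>ln D\<rfloor>) = D * exp (- y)"
    using assms by (simp add: y_def exp_diff)
  moreover have "two_power_max a b (D * exp (- y)) \<le> two_power_max a b D * two_power_max a b (exp (- y))"
    using assms by (intro two_power_max_mult) auto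
  moreover have "two_power_max a b (exp (- y)) \<le> exp (\<bar>a\<bar> + \<bar>b\<bar>)"
  proof -
    have "c * y \<le> \<bar>a\<bar> + \<bar>b\<bar>" if "c = a \<or> c = b" for c
    proof -
      have "c * y \<le> \<bar>c\<bar> * y" using y by (intro mult_right_mono) auto
      also have "\<dots> \<le> \<bar>c\<bar>" using y by (intro mult_left_le) auto
      finally show ?thesis using that by auto
    qed
    then show ?thesis by (simp add: two_power_max_def powr_def)
  qed
  ultimately show ?thesis
    using two_power_max_pos[OF assms, of a b] by (smt (verit) mult_left_mono)
qed

locale shift_on_ri_space = ri_curve + curve_shift
begin

text \<open>This constant limits the slices of the \<open>n\<close>-th iterate to the integers
  between \<open>- c * n\<close> and \<open>c * n\<close>, and later controls the effect of
  perturbing the exponents.\<close>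

lemma jac_exp_bounds:
  obtains c :: nat where "\<And>\<tau>. \<tau> \<in> \<Gamma> \<Longrightarrow> \<bar>ln (jac \<tau>)\<bar> \<le> real c"
proof -
  have "continuous_on \<Gamma> (\<lambda>\<tau>. ln (jac \<tau>))"
    by (intro continuous_on_ln jac_cont) (use jac_pos in force)
  then have "bounded ((\<lambda>\<tau>. ln (jac \<tau>)) ` \<Gamma>)"
    by (intro compact_imp_bounded compact_continuous_image compact_curve)
  then obtain B where B: "\<And>\<tau>. \<tau> \<in> \<Gamma> \<Longrightarrow> \<bar>ln (jac \<tau>)\<bar> \<le> B"
    unfolding bounded_real by blast
  obtain c :: nat where "B \<le> real c" using real_arch_simple by blast
  then show thesis using that B order_trans by blast
qed

definition iter_jac :: "nat \<Rightarrow> complex \<Rightarrow> real" where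
  "iter_jac n \<tau> = (\<Prod>j<n. jac ((\<alpha> ^^ j) \<tau>))"

lemma iter_jac_pos: "\<tau> \<in> \<Gamma> \<Longrightarrow> iter_jac n \<tau> > 0"
  unfolding iter_jac_def by (intro prod_pos ballI jac_pos maps_iter)

lemma iter_jac_measurable: "iter_jac n \<in> borel_measurable M"
proof -
  note [measurable] = alpha_iter_measurable continuous_measurable[OF jac_cont]
  have "(\<lambda>\<tau>. \<Prod>j<n. jac ((\<alpha> ^^ j) \<tau>)) \<in> borel_measurable M" by measurable
  then show ?thesis unfolding iter_jac_def[abs_def] .
qed

lemma abs_ln_iter_jac:
  assumes c: "\<And>\<tau>. \<tau> \<in> \<Gamma> \<Longrightarrow> \<bar>ln (jac \<tau>)\<bar> \<le> real c" and \<tau>: "\<tau> \<in> \<Gamma>"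
  shows "\<bar>ln (iter_jac n \<tau>)\<bar> \<le> real (c * n)"
proof -
  have "jac ((\<alpha> ^^ j) \<tau>) \<noteq> 0" for j using jac_pos[OF maps_iter[OF \<tau>], of j] by simp
  then have "ln (iter_jac n \<tau>) = (\<Sum>j<n. ln (jac ((\<alpha> ^^ j) \<tau>)))"
    unfolding iter_jac_def by (intro ln_prod) auto
  also have "\<bar>\<dots>\<bar> \<le> (\<Sum>j<n. \<bar>ln (jac ((\<alpha> ^^ j) \<tau>))\<bar>)" by (rule sum_abs)
  also have "\<dots> \<le> (\<Sum>j<n. real c)" by (intro sum_mono c maps_iter \<tau>)
  finally show ?thesis by (simp add: mult.commute)
qed

text \<open>The part of the curve on which \<open>(\<alpha>^^n)'\<close> lies between \<open>e\<^sup>k\<close> and \<open>e\<^sup>k\<^sup>+\<^sup>1\<close>: there composition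
  with \<open>\<alpha>^^n\<close> behaves like a dilation by \<open>e\<^sup>-\<^sup>k\<close>.\<close>

definition level_part :: "nat \<Rightarrow> int \<Rightarrow> (complex \<Rightarrow> ennreal) \<Rightarrow> complex \<Rightarrow> ennreal" where
  "level_part n k f \<tau> = (if \<lfloor>ln (iter_jac n \<tau>)\<rfloor> = k then f ((\<alpha> ^^ n) \<tau>) else 0)"

lemma level_part_measurable:
  assumes f: "f \<in> borel_measurable M"
  shows "level_part n k f \<in> borel_measurable M"
proof -
  note [measurable] = iter_jac_measurable measurable_compose[OF alpha_iter_measurable f]
  have "(\<lambda>\<tau>. if \<lfloor>ln (iter_jac n \<tau>)\<rfloor> = k then f ((\<alpha> ^^ n) \<tau>) else 0) \<in> borel_measurable M"
    by measurable
  then show ?thesis unfolding level_part_def[abs_def] .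
qed

text \<open>On the slice the Jacobian of the iterate is at least \<open>exp k\<close>. A superlevel
  set of the slice is therefore dominated by \<open>exp (- k)\<close> times the pulled back
  superlevel set weighted with that Jacobian, and substitution evaluates the integral.\<close>

lemma rho_level_part:
  assumes f: "f \<in> borel_measurable M" and fin: "\<rho> f < \<infinity>"
  shows "\<rho> (level_part n k f) \<le> dilation_norm (exp (- of_int k)) * \<rho> f"
proof (rule rho_le_dilation_norm[OF level_part_measurable[OF f] f _ fin])
  fix t :: real assume "t \<ge> 0"
  define A where "A = {\<tau>\<in>space M. level_part n k f \<tau> > ennreal t}"
  define B where "B = {\<tau>\<in>space M. f \<tau> > ennreal t}"
  have A: "A \<in> sets M" unfolding A_def
    by (rule borel_measurable_less[OF borel_measurable_const level_part_measurable[OF f]])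
  have B: "B \<in> sets M" unfolding B_def by (rule borel_measurable_less[OF borel_measurable_const f])
  have ind: "(indicator B :: complex \<Rightarrow> ennreal) \<in> borel_measurable M"
    using B by (rule borel_measurable_indicator)
  have m: "(\<lambda>x. indicator B ((\<alpha> ^^ n) x) * ennreal (iter_jac n x)) \<in> borel_measurable M"
    by (intro borel_measurable_times_ennreal measurable_compose[OF alpha_iter_measurable ind]
        measurable_compose[OF iter_jac_measurable measurable_ennreal])
  have "distribution_fun M (level_part n k f) t = (\<integral>\<^sup>+x. indicator A x \<partial>M)"
    unfolding distribution_fun_def A_def[symmetric] using A by simp
  also have "\<dots> \<le> (\<integral>\<^sup>+x. ennreal (exp (- of_int k)) * (indicator B ((\<alpha> ^^ n) x) * ennreal (iter_jac n x)) \<partial>M)"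
  proof (rule nn_integral_mono)
    fix x assume "x \<in> space M"
    then have x: "x \<in> \<Gamma>" by simp
    show "indicator A x \<le> ennreal (exp (- of_int k)) * (indicator B ((\<alpha> ^^ n) x) * ennreal (iter_jac n x))"
    proof (cases "x \<in> A")
      case True
      then have k: "\<lfloor>ln (iter_jac n x)\<rfloor> = k" and "f ((\<alpha> ^^ n) x) > ennreal t"
        unfolding A_def level_part_def by (auto split: if_splits)
      then have "(\<alpha> ^^ n) x \<in> B" using maps_iter[OF x] by (simp add: B_def)
      moreover have "of_int k \<le> ln (iter_jac n x)" using k by linarith
      then have "exp (of_int k) \<le> iter_jac n x" using iter_jac_pos[OF x] by (simp add: ln_ge_iff)
      then have "ennreal 1 \<le> ennreal (exp (- of_int k) * iter_jac n x)"
        by (intro ennreal_leI) (simp add: exp_minus field_simps)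
      ultimately show ?thesis using True by (simp add: ennreal_mult')
    qed simp
  qed
  also have "\<dots> = ennreal (exp (- of_int k)) * (\<integral>\<^sup>+x. indicator B ((\<alpha> ^^ n) x) * ennreal (iter_jac n x) \<partial>M)"
    by (rule nn_integral_cmult[OF m])
  also have "(\<integral>\<^sup>+x. indicator B ((\<alpha> ^^ n) x) * ennreal (iter_jac n x) \<partial>M) = (\<integral>\<^sup>+x. indicator B x \<partial>M)"
    unfolding iter_jac_def by (rule nn_integral_shift_iter[OF ind])
  also have "\<dots> = distribution_fun M f t"
    unfolding distribution_fun_def B_def[symmetric] using B by simp
  finally show "distribution_fun M (level_part n k f) t \<le> ennreal (exp (- of_int k)) * distribution_fun M f t" .
qed simp

text \<open>On slice \<open>k\<close> the factor from \<open>g\<close> is at most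
  \<open>d k\<close>, which contains the reciprocal of the very \<open>m k\<close> that bounds the
  dilation norm. The two cancel, every slice contributes the same amount, and the number of slices
  produces the factor \<open>Suc n\<close>.\<close>

lemma iterate_norm_bound:
  fixes g :: "complex \<Rightarrow> complex"
  assumes upper_pos: "boyd_upper \<gamma> L \<rho> > 0" and a: "a < boyd_lower \<gamma> L \<rho>" and b: "boyd_upper \<gamma> L \<rho> < b"
    and g: "continuous_on \<Gamma> g" and q: "q > 0"
    and wq: "\<And>\<tau>. \<tau> \<in> \<Gamma> \<Longrightarrow> \<alpha> \<tau> = \<tau> \<Longrightarrow> cmod (g \<tau>) * two_power_max a b (jac \<tau>) < q"
  obtains C where "C > 0"
    "\<And>n f. f \<in> borel_measurable M \<Longrightarrow> \<rho> f < \<infinity> \<Longrightarrow>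
       \<rho> (\<lambda>x. ennreal (cmod (\<Prod>j<n. g ((\<alpha> ^^ j) x))) * f ((\<alpha> ^^ n) x)) \<le> ennreal (C * real (Suc n) * q ^ n) * \<rho> f"
proof -
  obtain c :: nat where c: "\<And>\<tau>. \<tau> \<in> \<Gamma> \<Longrightarrow> \<bar>ln (jac \<tau>)\<bar> \<le> real c" using jac_exp_bounds by blast
  obtain C0 where C0: "C0 > 0" "\<And>x. x > 0 \<Longrightarrow> dilation_norm x \<le> ennreal (C0 * max (x powr a) (x powr b))"
    using dilation_norm_growth[OF upper_pos a b] by blast
  have dil: "dilation_norm (exp (- of_int k)) \<le> ennreal (C0 * two_power_max a b (exp (of_int k)))" for k
    using C0(2)[of "exp (- of_int k)"] by (simp add: two_power_max_def powr_def)
  define w where "w \<tau> = cmod (g \<tau>) * two_power_max a b (jac \<tau>)" for \<tau>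
  have w: "continuous_on \<Gamma> w"
    unfolding w_def two_power_max_def using jac_pos
    by (intro continuous_on_mult continuous_on_norm g continuous_on_max continuous_on_powr jac_cont
        continuous_on_const) force+
  have w0: "0 \<le> w \<tau>" if "\<tau> \<in> \<Gamma>" for \<tau>
    unfolding w_def using two_power_max_pos[OF jac_pos[OF that], of a b] by simp
  have wq': "w \<tau> < q" if "\<tau> \<in> \<Gamma>" "\<alpha> \<tau> = \<tau>" for \<tau>
    unfolding w_def using wq that by blast
  obtain C1 where C1: "C1 > 0" "\<And>\<tau> n. \<tau> \<in> \<Gamma> \<Longrightarrow> (\<Prod>j<n. w ((\<alpha> ^^ j) \<tau>)) \<le> C1 * q ^ n"
    using orbit_product_bound[OF w w0 q wq'] by blast
  define E where "E = exp (\<bar>a\<bar> + \<bar>b\<bar>)"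
  define C where "C = real (2 * c + 1) * (C1 * E * C0)"
  have E: "E > 0" by (simp add: E_def)
  show thesis
  proof (rule that[of C])
    show "C > 0" unfolding C_def using C0(1) C1(1) E by (intro mult_pos_pos) auto
    fix n f assume f: "f \<in> borel_measurable M" and fin: "\<rho> f < \<infinity>"
    define P where "P x = cmod (\<Prod>j<n. g ((\<alpha> ^^ j) x))" for x
    define m where "m k = two_power_max a b (exp (of_int k))" for k :: int
    have m: "m k > 0" for k unfolding m_def by (simp add: two_power_max_pos)
    define d where "d k = C1 * q ^ n * E / m k" for k
    have d: "d k \<ge> 0" for k unfolding d_def using C1(1) q E m[of k] by simp
    \<comment> \<open>Submultiplicativity of \<open>two_power_max\<close> bounds its value at the
      Jacobian of the iterate by the product along the orbit. Together with \<open>g\<close> this is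
      the orbit product of \<open>w\<close>; \<open>E\<close> pays for the rounding.\<close>
    have Pd: "P x \<le> d \<lfloor>ln (iter_jac n x)\<rfloor>" if x: "x \<in> \<Gamma>" for x
    proof -
      let ?k = "\<lfloor>ln (iter_jac n x)\<rfloor>"
      have "P x * two_power_max a b (iter_jac n x) \<le> P x * (\<Prod>j<n. two_power_max a b (jac ((\<alpha> ^^ j) x)))"
        unfolding iter_jac_def
        by (intro mult_left_mono two_power_max_prod jac_pos maps_iter x) (auto simp: P_def)
      also have "\<dots> = (\<Prod>j<n. w ((\<alpha> ^^ j) x))"
        unfolding P_def w_def by (simp add: prod.distrib prod_norm)
      also have "\<dots> \<le> C1 * q ^ n" by (rule C1(2)[OF x])
      finally have 1: "P x * two_power_max a b (iter_jac n x) \<le> C1 * q ^ n" .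
      have "m ?k \<le> two_power_max a b (iter_jac n x) * E"
        unfolding m_def E_def by (rule two_power_max_floor[OF iter_jac_pos[OF x]])
      then have "P x * m ?k \<le> P x * (two_power_max a b (iter_jac n x) * E)"
        by (rule mult_left_mono) (simp add: P_def)
      also have "\<dots> \<le> C1 * q ^ n * E" using mult_right_mono[OF 1, of E] E by (simp add: mult.assoc)
      finally show ?thesis unfolding d_def using m[of ?k] by (simp add: pos_le_divide_eq)
    qed
    define I where "I = {- int (c * n)..int (c * n)}"
    have I: "finite I" by (simp add: I_def)
    have card_I: "card I = 2 * (c * n) + 1" unfolding I_def card_atLeastAtMost_int by linarith
    have kI: "\<lfloor>ln (iter_jac n x)\<rfloor> \<in> I" if "x \<in> \<Gamma>" for x
    proof -
      from abs_ln_iter_jac[OF c that, of n]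
      have "- real (c * n) \<le> ln (iter_jac n x)" "ln (iter_jac n x) \<le> real (c * n)" by linarith+
      then show ?thesis unfolding I_def atLeastAtMost_iff by linarith
    qed
    have lm: "(\<lambda>x. ennreal (d k) * level_part n k f x) \<in> borel_measurable M" for k
      by (intro borel_measurable_times_ennreal borel_measurable_const level_part_measurable f)
    note g' = measurable_compose[OF alpha_iter_measurable continuous_measurable[OF g]]
    have "(\<lambda>x. \<Prod>j<n. g ((\<alpha> ^^ j) x)) \<in> borel_measurable M" by (intro borel_measurable_prod g')
    then have "P \<in> borel_measurable M" unfolding P_def[abs_def] by measurable
    then have Pm: "(\<lambda>x. ennreal (P x) * f ((\<alpha> ^^ n) x)) \<in> borel_measurable M"
      by (intro borel_measurable_times_ennreal measurable_compose[OF alpha_iter_measurable f]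
          measurable_compose[OF _ measurable_ennreal])
    have "\<rho> (\<lambda>x. ennreal (P x) * f ((\<alpha> ^^ n) x)) \<le> \<rho> (\<lambda>x. \<Sum>k\<in>I. ennreal (d k) * level_part n k f x)"
    proof (rule rho_mono[OF borel_measurable_sum[OF lm] Pm], rule AE_I2)
      fix x assume "x \<in> space M"
      then have x: "x \<in> \<Gamma>" by simp
      let ?k = "\<lfloor>ln (iter_jac n x)\<rfloor>"
      have "ennreal (P x) * f ((\<alpha> ^^ n) x) \<le> ennreal (d ?k) * level_part n ?k f x"
        unfolding level_part_def by (simp add: mult_right_mono ennreal_leI Pd[OF x])
      also have "\<dots> \<le> (\<Sum>k\<in>I. ennreal (d k) * level_part n k f x)"
        by (rule member_le_sum[OF kI[OF x]]) (auto simp: I)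
      finally show "ennreal (P x) * f ((\<alpha> ^^ n) x) \<le> (\<Sum>k\<in>I. ennreal (d k) * level_part n k f x)" .
    qed
    also have "\<dots> \<le> (\<Sum>k\<in>I. \<rho> (\<lambda>x. ennreal (d k) * level_part n k f x))"
      by (rule rho_sum[OF I lm])
    also have "\<dots> \<le> (\<Sum>k\<in>I. ennreal (C1 * E * C0 * q ^ n) * \<rho> f)"
    proof (rule sum_mono)
      fix k
      have "\<rho> (\<lambda>x. ennreal (d k) * level_part n k f x) = ennreal (d k) * \<rho> (level_part n k f)"
        by (rule rho_scale[OF level_part_measurable[OF f] d])
      also have "\<dots> \<le> ennreal (d k) * (ennreal (C0 * m k) * \<rho> f)"
        unfolding m_def
        by (intro mult_left_mono order_trans[OF rho_level_part[OF f fin, of n k] mult_right_mono[OF dil[of k]]]) auto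
      also have "\<dots> = ennreal (d k * (C0 * m k)) * \<rho> f"
        using d[of k] C0(1) m[of k] by (simp add: ennreal_mult mult.assoc)
      also have "d k * (C0 * m k) = C1 * E * C0 * q ^ n"
        unfolding d_def using m[of k] by simp
      finally show "\<rho> (\<lambda>x. ennreal (d k) * level_part n k f x) \<le> ennreal (C1 * E * C0 * q ^ n) * \<rho> f" .
    qed
    also have "\<dots> = ennreal (real (2 * (c * n) + 1)) * (ennreal (C1 * E * C0 * q ^ n) * \<rho> f)"
      by (simp add: card_I ennreal_of_nat_eq_real_of_nat)
    also have "\<dots> = ennreal (real (2 * (c * n) + 1) * (C1 * E * C0 * q ^ n)) * \<rho> f"
      using C0(1) C1(1) E q by (subst ennreal_mult) (auto simp: mult.assoc)
    also have "\<dots> \<le> ennreal (C * real (Suc n) * q ^ n) * \<rho> f"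
    proof (intro mult_right_mono ennreal_leI)
      have "real (2 * (c * n) + 1) \<le> real (2 * c + 1) * real (Suc n)" by (simp add: algebra_simps)
      from mult_right_mono[OF this, of "C1 * E * C0 * q ^ n"]
      show "real (2 * (c * n) + 1) * (C1 * E * C0 * q ^ n) \<le> C * real (Suc n) * q ^ n"
        using C0(1) C1(1) E q unfolding C_def by (simp add: mult_ac)
    qed simp
    finally show "\<rho> (\<lambda>x. ennreal (cmod (\<Prod>j<n. g ((\<alpha> ^^ j) x))) * f ((\<alpha> ^^ n) x))
        \<le> ennreal (C * real (Suc n) * q ^ n) * \<rho> f"
      unfolding P_def .
  qed
qed

text \<open>For each \<open>q > S\<close> exponents slightly outside the indices keep the weight at
  the fixed points below \<open>q\<close>, so the iterates grow at most like
  \<open>Suc n * q ^ n\<close>. Choosing \<open>q\<close> between \<open>S\<close> and the modulus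
  of \<open>z\<close> makes the Neumann series converge.\<close>

lemma spectral_radius_le:
  fixes g :: "complex \<Rightarrow> complex"
  assumes upper_pos: "boyd_upper \<gamma> L \<rho> > 0" and g: "continuous_on \<Gamma> g" and S0: "S \<ge> 0"
    and S: "\<And>\<tau>. \<tau> \<in> \<Gamma> \<Longrightarrow> \<alpha> \<tau> = \<tau> \<Longrightarrow>
      cmod (g \<tau>) * two_power_max (boyd_lower \<gamma> L \<rho>) (boyd_upper \<gamma> L \<rho>) (jac \<tau>) \<le> S"
  shows "spectral_radius M \<rho> (weighted_shift g \<alpha>) \<le> S"
proof -
  obtain c :: nat where c: "\<And>\<tau>. \<tau> \<in> \<Gamma> \<Longrightarrow> \<bar>ln (jac \<tau>)\<bar> \<le> real c" using jac_exp_bounds by blast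
  have bound: "\<exists>C>0. \<forall>n f. f \<in> borel_measurable M \<longrightarrow> \<rho> f < \<infinity> \<longrightarrow>
       \<rho> (\<lambda>x. ennreal (cmod (\<Prod>j<n. g ((\<alpha> ^^ j) x))) * f ((\<alpha> ^^ n) x)) \<le> ennreal (C * real (Suc n) * q ^ n) * \<rho> f"
    if q: "q > S" for q
  proof -
    \<comment> \<open>\<open>S\<close> may be 0; an intermediate positive number can be divided
      by.\<close>
    define S1 where "S1 = (S + q) / 2"
    have S1: "S < S1" "S1 < q" "0 < S1" using q S0 by (auto simp: S1_def)
    \<comment> \<open>Moving an exponent by \<delta> costs a factor of at most
      \<open>exp (c *\<close>\<delta>\<open>)\<close>, which has to stay below
      \<open>q / S1\<close>. The summand 1 gives strictness and covers \<open>c = 0\<close>.\<close>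
    define \<delta> where "\<delta> = ln (q / S1) / (real c + 1)"
    have \<delta>: "\<delta> > 0" unfolding \<delta>_def using S1 by (intro divide_pos_pos ln_gt_zero) auto
    have "real c * \<delta> < (real c + 1) * \<delta>" using \<delta> by simp
    also have "\<dots> = ln (q / S1)" by (simp add: \<delta>_def)
    finally have "exp (real c * \<delta>) < q / S1" using S1 q S0 by (metis exp_less_mono exp_ln divide_pos_pos le_less_trans)
    then have *: "S1 * exp (real c * \<delta>) < q" using S1 by (simp add: field_simps)
    define a where "a = boyd_lower \<gamma> L \<rho> - \<delta>"
    define b where "b = boyd_upper \<gamma> L \<rho> + \<delta>"
    have "cmod (g \<tau>) * two_power_max a b (jac \<tau>) < q" if \<tau>: "\<tau> \<in> \<Gamma>" "\<alpha> \<tau> = \<tau>" for \<tau>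
    proof -
      have J: "jac \<tau> > 0" by (rule jac_pos[OF \<tau>(1)])
      have cd: "- (real c * \<delta>) \<le> ln (jac \<tau>) * \<delta>" "ln (jac \<tau>) * \<delta> \<le> real c * \<delta>"
        using mult_right_mono[of "- real c" "ln (jac \<tau>)" \<delta>] mult_right_mono[of "ln (jac \<tau>)" "real c" \<delta>]
          c[OF \<tau>(1)] \<delta> by auto
      have "jac \<tau> powr (- a) \<le> exp (real c * \<delta>) * jac \<tau> powr (- boyd_lower \<gamma> L \<rho>)"
        using cd J by (simp add: powr_def a_def exp_add[symmetric] algebra_simps)
      moreover have "jac \<tau> powr (- b) \<le> exp (real c * \<delta>) * jac \<tau> powr (- boyd_upper \<gamma> L \<rho>)"
        using cd J by (simp add: powr_def b_def exp_add[symmetric] algebra_simps)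
      ultimately have "two_power_max a b (jac \<tau>)
          \<le> exp (real c * \<delta>) * two_power_max (boyd_lower \<gamma> L \<rho>) (boyd_upper \<gamma> L \<rho>) (jac \<tau>)"
        unfolding two_power_max_def max_mult_distrib_left by (simp only: exp_ge_zero if_True max.mono)
      then have "cmod (g \<tau>) * two_power_max a b (jac \<tau>)
          \<le> cmod (g \<tau>) * (exp (real c * \<delta>) * two_power_max (boyd_lower \<gamma> L \<rho>) (boyd_upper \<gamma> L \<rho>) (jac \<tau>))"
        by (rule mult_left_mono) simp
      also have "\<dots> = (cmod (g \<tau>) * two_power_max (boyd_lower \<gamma> L \<rho>) (boyd_upper \<gamma> L \<rho>) (jac \<tau>)) * exp (real c * \<delta>)"
        by (simp only: mult_ac)
      also have "\<dots> \<le> S * exp (real c * \<delta>)" by (intro mult_right_mono S \<tau>) simp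
      also have "\<dots> \<le> S1 * exp (real c * \<delta>)" using S1 by (intro mult_right_mono) auto
      also note *
      finally show ?thesis .
    qed
    then obtain C where "C > 0" "\<And>n f. f \<in> borel_measurable M \<Longrightarrow> \<rho> f < \<infinity> \<Longrightarrow>
       \<rho> (\<lambda>x. ennreal (cmod (\<Prod>j<n. g ((\<alpha> ^^ j) x))) * f ((\<alpha> ^^ n) x)) \<le> ennreal (C * real (Suc n) * q ^ n) * \<rho> f"
      using iterate_norm_bound[OF upper_pos, of a b g q] g \<delta> q S0 unfolding a_def b_def by auto
    then show ?thesis by blast
  qed
  have gm: "g \<in> borel_measurable M" by (rule continuous_measurable[OF g])
  have ws: "weighted_shift g \<alpha> = (\<lambda>f x. g x * f (\<alpha> x))"
    by (simp add: weighted_shift_def fun_eq_iff)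
  have le: "cmod z \<le> S" if z: "z \<in> op_spectrum M \<rho> (weighted_shift g \<alpha>)" for z
  proof (rule ccontr)
    assume "\<not> cmod z \<le> S"
    define q where "q = (S + cmod z) / 2"
    have q: "S < q" "q < cmod z" "q > 0" using \<open>\<not> cmod z \<le> S\<close> S0 by (auto simp: q_def)
    obtain C where C: "C > 0" "\<forall>n f. f \<in> borel_measurable M \<longrightarrow> \<rho> f < \<infinity> \<longrightarrow>
       \<rho> (\<lambda>x. ennreal (cmod (\<Prod>j<n. g ((\<alpha> ^^ j) x))) * f ((\<alpha> ^^ n) x)) \<le> ennreal (C * real (Suc n) * q ^ n) * \<rho> f"
      using bound[OF q(1)] by blast
    have "\<bar>q\<bar> / cmod z < 1" using q by (subst pos_divide_less_eq) auto
    \<comment> \<open>The linear factor coming from the number of slices is absorbed by the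
      differentiated geometric series.\<close>
    then have "(\<lambda>n. of_nat (Suc n) * (q / cmod z) ^ n) sums (1 / (1 - q / cmod z)\<^sup>2)"
      by (intro geometric_deriv_sums) simp
    then have "summable (\<lambda>n. of_nat (Suc n) * (q / cmod z) ^ n)" by (rule sums_summable)
    then have "summable (\<lambda>n. C / cmod z * (of_nat (Suc n) * (q / cmod z) ^ n))" by (rule summable_mult)
    moreover have "C / cmod z * (of_nat (Suc n) * (q / cmod z) ^ n) = C * real (Suc n) * q ^ n / cmod z ^ Suc n" for n
      by (simp add: power_divide)
    ultimately have sm: "summable (\<lambda>n. C * real (Suc n) * q ^ n / cmod z ^ Suc n)"
      by (simp only:)
    have "z \<noteq> 0" using q by auto
    have "bounded_invertible_on M \<rho> (\<lambda>f x. z * f x - g x * f (\<alpha> x))"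
      by (rule neumann_series_invertible[OF gm alpha_measurable \<open>z \<noteq> 0\<close> _ sm]) (use C q in auto)
    then show False using z unfolding op_spectrum_def ws by simp
  qed
  \<comment> \<open>A conditional supremum can be bounded only for a nonempty set. The operator
    bound needed for this is the case \<open>n = 1\<close> of \<open>bound\<close>, with
    \<open>q = S + 1\<close>.\<close>
  have ne: "op_spectrum M \<rho> (weighted_shift g \<alpha>) \<noteq> {}"
  proof -
    obtain C where C: "C > 0" "\<forall>n f. f \<in> borel_measurable M \<longrightarrow> \<rho> f < \<infinity> \<longrightarrow>
       \<rho> (\<lambda>x. ennreal (cmod (\<Prod>j<n. g ((\<alpha> ^^ j) x))) * f ((\<alpha> ^^ n) x)) \<le> ennreal (C * real (Suc n) * (S + 1) ^ n) * \<rho> f"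
      using bound[of "S + 1"] by auto
    have T: "weighted_shift g \<alpha> f \<in> X_space M \<rho>"
      "X_norm \<rho> (weighted_shift g \<alpha> f) \<le> (C * 2 * (S + 1)) * X_norm \<rho> f" if f: "f \<in> X_space M \<rho>" for f
    proof -
      have fm: "(\<lambda>x. ennreal (cmod (f x))) \<in> borel_measurable M"
        using X_spaceD(1)[OF f] by measurable
      have ffin: "\<rho> (\<lambda>x. ennreal (cmod (f x))) < \<infinity>" using f by (simp add: X_space_def)
      have "\<rho> (\<lambda>x. ennreal (cmod (weighted_shift g \<alpha> f x)))
          = \<rho> (\<lambda>x. ennreal (cmod (\<Prod>j<1. g ((\<alpha> ^^ j) x))) * ennreal (cmod (f ((\<alpha> ^^ 1) x))))"
        by (simp add: weighted_shift_def norm_mult ennreal_mult)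
      also have "\<dots> \<le> ennreal (C * real (Suc 1) * (S + 1) ^ 1) * \<rho> (\<lambda>x. ennreal (cmod (f x)))"
        using C(2) fm ffin by blast
      also have "\<dots> = ennreal ((C * 2 * (S + 1)) * X_norm \<rho> f)"
        using C(1) S0 by (simp add: X_spaceD(2)[OF f] ennreal_mult X_norm_nonneg)
      finally have 1: "\<rho> (\<lambda>x. ennreal (cmod (weighted_shift g \<alpha> f x))) \<le> ennreal ((C * 2 * (S + 1)) * X_norm \<rho> f)" .
      have 2: "weighted_shift g \<alpha> f \<in> borel_measurable M"
        unfolding ws using measurable_compose[OF alpha_measurable X_spaceD(1)[OF f]] gm
        by (intro borel_measurable_times)
      show "weighted_shift g \<alpha> f \<in> X_space M \<rho>"
        "X_norm \<rho> (weighted_shift g \<alpha> f) \<le> (C * 2 * (S + 1)) * X_norm \<rho> f"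
        using X_norm_leI[OF 2 1] C(1) S0 X_norm_nonneg[of f] by simp_all
    qed
    show ?thesis
      by (rule op_spectrum_nonempty[OF _ T]) (use L_pos in \<open>simp_all add: measure_curve\<close>)
  qed
  show ?thesis unfolding spectral_radius_def
    using ne le by (intro cSUP_least)
qed

end

theorem theorem3p2:
  fixes \<gamma> :: "real \<Rightarrow> complex" and L :: real
    and \<alpha> :: "complex \<Rightarrow> complex" and g :: "complex \<Rightarrow> complex"
    and \<rho> :: "(complex \<Rightarrow> ennreal) \<Rightarrow> ennreal"
  assumes curve: "smooth_jordan_curve \<gamma> L"
    and diffeo: "curve_diffeo (curve_set \<gamma> L) \<alpha>"
    and orient: "orientation_preserving \<gamma> \<alpha>"
    and fixpts: "{\<tau> \<in> curve_set \<gamma> L. \<alpha> \<tau> = \<tau>} \<noteq> {}"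
    and ri: "ri_bfs (arc_measure \<gamma> L) \<rho>"
    and boyd: "0 < boyd_lower \<gamma> L \<rho>" "boyd_lower \<gamma> L \<rho> \<le> boyd_upper \<gamma> L \<rho>"
              "boyd_upper \<gamma> L \<rho> < 1"
    and g: "continuous_on (curve_set \<gamma> L) g"
  shows "spectral_radius (arc_measure \<gamma> L) \<rho> (weighted_shift g \<alpha>)
    \<le> (SUP \<tau>\<in>{\<tau> \<in> curve_set \<gamma> L. \<alpha> \<tau> = \<tau>}.
          cmod (g \<tau>) * max (cmod (curve_deriv (curve_set \<gamma> L) \<alpha> \<tau>) powr (- boyd_lower \<gamma> L \<rho>))
                            (cmod (curve_deriv (curve_set \<gamma> L) \<alpha> \<tau>) powr (- boyd_upper \<gamma> L \<rho>)))"
proof -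
  interpret shift_on_ri_space \<gamma> L \<rho> \<alpha>
    by unfold_locales (fact curve ri diffeo orient fixpts)+
  let ?\<Lambda> = "{\<tau> \<in> curve_set \<gamma> L. \<alpha> \<tau> = \<tau>}"
  define V where "V \<tau> = cmod (g \<tau>) * two_power_max (boyd_lower \<gamma> L \<rho>) (boyd_upper \<gamma> L \<rho>) (jac \<tau>)" for \<tau>
  \<comment> \<open>Continuity on the compact curve bounds the weights; without that the real
    supremum over the fixed points would not be an upper bound.\<close>
  have "continuous_on (curve_set \<gamma> L) V"
    unfolding V_def two_power_max_def using jac_pos
    by (intro continuous_on_mult continuous_on_norm g continuous_on_max continuous_on_powr jac_cont
        continuous_on_const) force+
  then have "bounded (V ` curve_set \<gamma> L)"
    by (intro compact_imp_bounded compact_continuous_image compact_curve)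
  then have bdd: "bdd_above (V ` ?\<Lambda>)"
    by (intro bounded_imp_bdd_above) (auto intro: bounded_subset)
  have V0: "0 \<le> V \<tau>" if "\<tau> \<in> curve_set \<gamma> L" for \<tau>
    unfolding V_def using two_power_max_pos[OF jac_pos[OF that]] by (simp add: less_imp_le)
  have upper: "V \<tau> \<le> (SUP \<tau>\<in>?\<Lambda>. V \<tau>)" if "\<tau> \<in> curve_set \<gamma> L" "\<alpha> \<tau> = \<tau>" for \<tau>
    using that by (intro cSUP_upper bdd) simp
  \<comment> \<open>One fixed point shows that the supremum is nonnegative, as required of
    \<open>S\<close>.\<close>
  obtain \<tau>0 where "\<tau>0 \<in> curve_set \<gamma> L" "\<alpha> \<tau>0 = \<tau>0" using fixpts by blast
  then have "0 \<le> (SUP \<tau>\<in>?\<Lambda>. V \<tau>)" using V0 upper by (blast intro: order_trans)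
  then have "spectral_radius (arc_measure \<gamma> L) \<rho> (weighted_shift g \<alpha>) \<le> (SUP \<tau>\<in>?\<Lambda>. V \<tau>)"
    using boyd upper by (intro spectral_radius_le g) (auto simp: V_def)
  then show ?thesis unfolding V_def two_power_max_def jac_def .
qed

end
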